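(* For every constant $\delta>0$ and all sufficiently large $n$, there is an $n$-point metric space of negative type (an $\ell_2^2$ metric) which cannot be embedded into $\ell_1$ with distortion less than $(\log\log n)^{1/6-\delta}$.
   Context: A finite metric space $(X,d)$ is of negative type if there are vectors $v_x\in\mathbb R^m$ ($x\in X$) with $d(x,y)=\|v_x-v_y\|^2$ for all $x,y$ (the vectors then satisfy $\|v_x-v_y\|^2+\|v_y-v_z\|^2\ge\|v_x-v_z\|^2$). A metric space $(X_1,d_1)$ embeds into $(X_2,d_2)$ with distortion at most $\Gamma$ if there is a map $\phi:X_1\to X_2$ with $d_1(x,y)\le d_2(\phi(x),\phi(y))\le\Gamma\, d_1(x,y)$ for all $x,y$. Embedding into $\ell_1$ means into some finite subset of $\mathbb R^m$ with the metric $\sum_i|x_i-y_i|$. *)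

theory Defs
  imports "HOL-Analysis.Analysis"
begin

text \<open>The dimension \<open>m\<close> is existentially quantified below, so \<open>\<real>\<^sup>m\<close> is the set of functions on the
  index set \<open>{..<m}\<close> (extensional, so that a vector is determined by its \<open>m\<close> coordinates).\<close>

definition real_vectors :: "nat \<Rightarrow> (nat \<Rightarrow> real) set" where
  "real_vectors m = {..<m} \<rightarrow>\<^sub>E UNIV"

text \<open>\<^const>\<open>L2_set\<close> is not squared: it is the Euclidean norm of the vector of coordinates.\<close>

definition negative_type :: "'a set \<Rightarrow> ('a \<Rightarrow> 'a \<Rightarrow> real) \<Rightarrow> bool" where
  "negative_type X d \<longleftrightarrow> finite X \<and> Metric_space X d \<and>
     (\<exists>m. \<exists>v \<in> X \<rightarrow> real_vectors m.
        \<forall>x\<in>X. \<forall>y\<in>X. d x y = (L2_set (\<lambda>i. v x i - v y i) {..<m})\<^sup>2)"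

text \<open>Normalised so that the map does not contract distances. A separate scaling factor is not
  needed for \<open>\<ell>\<^sub>1\<close> targets, which can themselves be rescaled.\<close>

definition embeds_with_distortion ::
    "'a set \<Rightarrow> ('a \<Rightarrow> 'a \<Rightarrow> real) \<Rightarrow> 'b set \<Rightarrow> ('b \<Rightarrow> 'b \<Rightarrow> real) \<Rightarrow> real \<Rightarrow> bool" where
  "embeds_with_distortion X\<^sub>1 d\<^sub>1 X\<^sub>2 d\<^sub>2 \<Gamma> \<longleftrightarrow>
     (\<exists>\<phi> \<in> X\<^sub>1 \<rightarrow> X\<^sub>2. \<forall>x\<in>X\<^sub>1. \<forall>y\<in>X\<^sub>1.
        d\<^sub>1 x y \<le> d\<^sub>2 (\<phi> x) (\<phi> y) \<and> d\<^sub>2 (\<phi> x) (\<phi> y) \<le> \<Gamma> * d\<^sub>1 x y)"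

definition l1_dist :: "nat \<Rightarrow> (nat \<Rightarrow> real) \<Rightarrow> (nat \<Rightarrow> real) \<Rightarrow> real" where
  "l1_dist m x y = (\<Sum>i<m. \<bar>x i - y i\<bar>)"

definition embeds_into_l1 :: "'a set \<Rightarrow> ('a \<Rightarrow> 'a \<Rightarrow> real) \<Rightarrow> real \<Rightarrow> bool" where
  "embeds_into_l1 X d \<Gamma> \<longleftrightarrow>
     (\<exists>m Y. finite Y \<and> Y \<subseteq> real_vectors m \<and> embeds_with_distortion X d Y (l1_dist m) \<Gamma>)"

end

theory Submission
  imports Defs
begin

text \<open>The points are the orbits of a group \<open>G\<close> of \<open>2 ^ m\<close> coordinate permutations, acting freely on
  the \<open>k\<close> coordinates of the cube \<open>{-1, 1}\<^sup>k\<close> with \<open>k = 2 ^ (10 * m)\<close>; only those orbits are kept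
  whose elements are nearly orthogonal. The kernel \<open>\<Sum>\<^sub>g \<langle>x, g y\<rangle>\<^sup>1\<^sup>0\<close>, with normalised inner products,
  is positive semidefinite and is dominated by the best correlation between the two orbits; together
  with a slack of \<open>1 / k\<close> this makes the squared Euclidean distance a metric. Typical distances are
  at least a constant while an edge of the cube has length \<open>O(1 / k)\<close>. A map into \<open>\<ell>\<^sub>1\<close> decomposes
  into cuts of the cube that are invariant under \<open>G\<close>, hence have small individual influences, and by
  the Kahn-Kalai-Linial theorem such a cut has total influence at least of order \<open>m\<close> times its
  variance. So the distortion is at least of order \<open>m\<close>, which is of order \<open>log log n\<close> for \<open>n = 2 ^ k\<close>;
  this exceeds \<open>(log log n) powr (1 / 6)\<close>.\<close>

section \<open>Fourier analysis on the cube\<close>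

text \<open>The natural distance between two orbits is governed by their largest correlation, but a
  maximum of kernels need not be positive semidefinite. A sum of even powers is, and for the orbits
  that are kept it stays close to its largest term, because near-orthogonality leaves room for only
  one large correlation. The obstacle is the triangle inequality, which the remaining terms can
  spoil. Part of their contribution is paid by the strict subadditivity of
  \<open>1 - (1 - u) ^ 10\<close>; a residue of order \<open>\<epsilon> ^ 7\<close> is left for
  orbits that are orthogonal up to \<open>\<epsilon>\<close>, and the slack absorbs it. The slack is
  added to the length of every edge of the cube, so it must not exceed the order
  \<open>1 / k\<close> that an edge has anyway. This forces \<open>\<epsilon>\<close> to be small,
  while all but a \<open>1 / k\<close> fraction of the cube must still satisfy the orthogonality
  condition. The exponent 10 is even, so signs disappear, and large enough: two factors are spent on
  Bessel's inequality and the others make the secondary terms small.\<close>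

definition signum_at :: "'a set \<Rightarrow> 'a \<Rightarrow> real" where
  "signum_at A i = (if i \<in> A then -1 else 1)"

definition walsh :: "'a set \<Rightarrow> 'a set \<Rightarrow> real" where
  "walsh S A = (\<Prod>i\<in>S. signum_at A i)"

definition cube_mean :: "'a set \<Rightarrow> ('a set \<Rightarrow> real) \<Rightarrow> real" where
  "cube_mean I f = (\<Sum>A\<in>Pow I. f A) / 2 ^ card I"

definition fourier :: "'a set \<Rightarrow> ('a set \<Rightarrow> real) \<Rightarrow> 'a set \<Rightarrow> real" where
  "fourier I f S = cube_mean I (\<lambda>A. f A * walsh S A)"

lemma signum_at_square [simp]: "signum_at A i * signum_at A i = 1"
  by (simp add: signum_at_def)

lemma abs_signum_at [simp]: "\<bar>signum_at A i\<bar> = 1"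
  by (simp add: signum_at_def)

lemma cube_mean_add: "cube_mean I (\<lambda>A. f A + g A) = cube_mean I f + cube_mean I g"
  by (simp add: cube_mean_def sum.distrib add_divide_distrib)

lemma cube_mean_diff: "cube_mean I (\<lambda>A. f A - g A) = cube_mean I f - cube_mean I g"
  by (simp add: cube_mean_def sum_subtractf diff_divide_distrib)

lemma cube_mean_cmult: "cube_mean I (\<lambda>A. c * f A) = c * cube_mean I f"
  by (simp add: cube_mean_def sum_distrib_left)

lemma cube_mean_sum: "cube_mean I (\<lambda>A. \<Sum>j\<in>J. f j A) = (\<Sum>j\<in>J. cube_mean I (f j))"
  by (simp add: cube_mean_def sum.swap[of _ _ "Pow I"] sum_divide_distrib)

lemma cube_mean_mono:
  "(\<And>A. A \<subseteq> I \<Longrightarrow> f A \<le> g A) \<Longrightarrow> cube_mean I f \<le> cube_mean I g"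
  unfolding cube_mean_def by (intro divide_right_mono sum_mono) auto

lemma cube_mean_nonneg: "(\<And>A. A \<subseteq> I \<Longrightarrow> 0 \<le> f A) \<Longrightarrow> 0 \<le> cube_mean I f"
  unfolding cube_mean_def by (intro divide_nonneg_nonneg sum_nonneg) auto

lemma cube_mean_cong:
  "(\<And>A. A \<subseteq> I \<Longrightarrow> f A = g A) \<Longrightarrow> cube_mean I f = cube_mean I g"
  unfolding cube_mean_def by (metis PowD sum.cong)

lemma cube_mean_const: "finite I \<Longrightarrow> cube_mean I (\<lambda>_. c) = c"
  by (simp add: cube_mean_def card_Pow)

lemma cube_mean_reindex:
  assumes "bij_betw \<tau> (Pow I) (Pow I)"
  shows "cube_mean I (\<lambda>A. f (\<tau> A)) = cube_mean I f"
  unfolding cube_mean_def using sum.reindex_bij_betw[OF assms, of f] by simp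

lemma cube_mean_Cauchy_Schwarz:
  "(cube_mean I (\<lambda>A. f A * g A))\<^sup>2 \<le> cube_mean I (\<lambda>A. (f A)\<^sup>2) * cube_mean I (\<lambda>A. (g A)\<^sup>2)"
  using Cauchy_Schwarz_ineq_sum[of f g "Pow I"]
  by (simp add: cube_mean_def power_divide power2_eq_square divide_right_mono)

lemma bij_betw_flip: "i \<in> I \<Longrightarrow> bij_betw (\<lambda>A. sym_diff A {i}) (Pow I) (Pow I)"
  by (rule bij_betw_byWitness[where f' = "\<lambda>A. sym_diff A {i}"]) auto

lemma sum_Pow_insert:
  assumes "finite I" "i \<notin> I"
  shows "(\<Sum>A\<in>Pow (insert i I). h A) = (\<Sum>A\<in>Pow I. h A + h (insert i A))"
proof -
  have inj: "inj_on (insert i) (Pow I)"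
    using assms by (auto simp: inj_on_def)
  have "(\<Sum>A\<in>Pow (insert i I). h A) = sum h (Pow I) + sum h (insert i ` Pow I)"
    unfolding Pow_insert using assms by (intro sum.union_disjoint) auto
  also have "\<dots> = (\<Sum>A\<in>Pow I. h A + h (insert i A))"
    by (simp add: sum.reindex[OF inj] sum.distrib)
  finally show ?thesis .
qed

lemma walsh_flip:
  assumes "finite S"
  shows "walsh S (sym_diff A {i}) = (if i \<in> S then - walsh S A else walsh S A)"
proof -
  have *: "walsh T (sym_diff A {i}) = walsh T A" if "i \<notin> T" for T
    unfolding walsh_def using that by (intro prod.cong) (auto simp: signum_at_def)
  show ?thesis
  proof (cases "i \<in> S")
    case True
    then have S: "S = insert i (S - {i})"
      by auto
    have "walsh S B = signum_at B i * walsh (S - {i}) B" for B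
      unfolding walsh_def using assms by (subst S, subst prod.insert) auto
    then show ?thesis
      using True *[of "S - {i}"] by (simp add: signum_at_def)
  qed (use * in auto)
qed

text \<open>The sum over \<open>S\<close> is the expansion of a product with factors
  \<open>1 + signum_at A i * signum_at B i\<close>; a coordinate where \<open>A\<close> and
  \<open>B\<close> disagree makes its factor vanish.\<close>

lemma walsh_kernel:
  assumes "finite I" "A \<subseteq> I" "B \<subseteq> I"
  shows "(\<Sum>S\<in>Pow I. walsh S A * walsh S B) = (if A = B then 2 ^ card I else 0)"
proof -
  have "(\<Sum>S\<in>Pow I. walsh S A * walsh S B) = (\<Prod>i\<in>I. signum_at A i * signum_at B i + 1)"
    by (subst prod_add[OF assms(1)]) (simp add: walsh_def prod.distrib)
  also have "\<dots> = (if A = B then 2 ^ card I else 0)"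
  proof (cases "A = B")
    case False
    then obtain i where "i \<in> I" "(i \<in> A) \<noteq> (i \<in> B)"
      using assms by blast
    then show ?thesis
      using False assms(1) by (auto simp: prod_zero_iff signum_at_def)
  qed simp
  finally show ?thesis .
qed

lemma parseval:
  assumes "finite I"
  shows "(\<Sum>S\<in>Pow I. (fourier I f S)\<^sup>2) = cube_mean I (\<lambda>A. (f A)\<^sup>2)"
proof -
  define N :: real where "N = 2 ^ card I"
  have N: "N > 0"
    by (simp add: N_def)
  have "(fourier I f S)\<^sup>2 = (\<Sum>A\<in>Pow I. \<Sum>B\<in>Pow I. f A * f B * (walsh S A * walsh S B)) / N\<^sup>2" for S
    by (simp add: fourier_def cube_mean_def power_divide N_def[symmetric] power2_eq_square
        sum_product mult_ac)
  then have "(\<Sum>S\<in>Pow I. (fourier I f S)\<^sup>2) =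
      (\<Sum>S\<in>Pow I. \<Sum>A\<in>Pow I. \<Sum>B\<in>Pow I. f A * f B * (walsh S A * walsh S B)) / N\<^sup>2"
    by (simp add: sum_divide_distrib)
  also have "(\<Sum>S\<in>Pow I. \<Sum>A\<in>Pow I. \<Sum>B\<in>Pow I. f A * f B * (walsh S A * walsh S B)) =
      (\<Sum>A\<in>Pow I. \<Sum>S\<in>Pow I. \<Sum>B\<in>Pow I. f A * f B * (walsh S A * walsh S B))"
    by (rule sum.swap)
  also have "\<dots> =
      (\<Sum>A\<in>Pow I. \<Sum>B\<in>Pow I. f A * f B * (\<Sum>S\<in>Pow I. walsh S A * walsh S B))"
    unfolding sum_distrib_left by (intro sum.cong refl sum.swap)
  also have "\<dots> = (\<Sum>A\<in>Pow I. \<Sum>B\<in>Pow I. if A = B then f A * f B * N else 0)"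
    using walsh_kernel[OF assms] by (intro sum.cong) (auto simp: N_def)
  also have "\<dots> = (\<Sum>A\<in>Pow I. f A * f A * N)"
    using assms by (simp add: sum.delta')
  finally show ?thesis
    using N by (simp add: cube_mean_def N_def[symmetric] power2_eq_square sum_distrib_right[symmetric])
qed

text \<open>This is (2,4)-hypercontractivity of the noise operator with parameter
  \<open>1 / sqrt 3\<close>. Splitting off a coordinate writes the sum as \<open>p\<close> plus or
  minus \<open>\<rho> * q\<close>; averaging the two signs kills the odd powers. The choice of
  \<open>\<rho>\<close> makes the mixed coefficient \<open>6 * \<rho>\<^sup>2\<close> equal to 2, so
  that Cauchy-Schwarz for the mixed term completes the square
  \<open>(a + b)\<^sup>2\<close>.\<close>

lemma bonami:
  assumes "finite I"
  shows "cube_mean I (\<lambda>A. (\<Sum>S\<in>Pow I. (1 / sqrt 3) ^ card S * c S * walsh S A) ^ 4)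
    \<le> (\<Sum>S\<in>Pow I. (c S)\<^sup>2)\<^sup>2"
  using assms
proof (induction I arbitrary: c)
  case empty
  then show ?case
    by (simp add: cube_mean_def walsh_def)
next
  case (insert i I)
  define \<rho> :: real where "\<rho> = 1 / sqrt 3"
  define p where "p A = (\<Sum>S\<in>Pow I. \<rho> ^ card S * c S * walsh S A)" for A
  define q where "q A = (\<Sum>S\<in>Pow I. \<rho> ^ card S * c (insert i S) * walsh S A)" for A
  define a where "a = (\<Sum>S\<in>Pow I. (c S)\<^sup>2)"
  define b where "b = (\<Sum>S\<in>Pow I. (c (insert i S))\<^sup>2)"
  have \<rho>2: "\<rho>\<^sup>2 = 1 / 3"
    by (simp add: \<rho>_def power_divide)
  have a0: "a \<ge> 0" and b0: "b \<ge> 0"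
    by (auto simp: a_def b_def intro: sum_nonneg)
  have p4: "cube_mean I (\<lambda>A. p A ^ 4) \<le> a\<^sup>2" and q4: "cube_mean I (\<lambda>A. q A ^ 4) \<le> b\<^sup>2"
    unfolding p_def q_def a_def b_def \<rho>_def
    using insert.IH[of c] insert.IH[of "\<lambda>S. c (insert i S)"] by simp_all
  have "(cube_mean I (\<lambda>A. (p A)\<^sup>2 * (q A)\<^sup>2))\<^sup>2
      \<le> cube_mean I (\<lambda>A. p A ^ 4) * cube_mean I (\<lambda>A. q A ^ 4)"
    using cube_mean_Cauchy_Schwarz[of I "\<lambda>A. (p A)\<^sup>2" "\<lambda>A. (q A)\<^sup>2"]
    by (simp flip: power_mult)
  also have "\<dots> \<le> a\<^sup>2 * b\<^sup>2"
    by (intro mult_mono p4 q4 cube_mean_nonneg) auto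
  finally have "(cube_mean I (\<lambda>A. (p A)\<^sup>2 * (q A)\<^sup>2))\<^sup>2 \<le> (a * b)\<^sup>2"
    by (simp add: power_mult_distrib)
  then have pq: "cube_mean I (\<lambda>A. (p A)\<^sup>2 * (q A)\<^sup>2) \<le> a * b"
    by (rule power2_le_imp_le) (use a0 b0 in simp)
  have w1: "walsh S (insert i A) = walsh S A" if "S \<subseteq> I" for S A
    unfolding walsh_def using that insert.hyps by (intro prod.cong) (auto simp: signum_at_def)
  have w2: "walsh (insert i S) A = signum_at A i * walsh S A" if "S \<subseteq> I" for S A
    unfolding walsh_def using that insert.hyps by (subst prod.insert) (auto intro: finite_subset)
  have card: "card (insert i S) = Suc (card S)" if "S \<subseteq> I" for S
    using that insert.hyps by (subst card_insert_disjoint) (auto intro: finite_subset)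
  have val: "(\<Sum>S\<in>Pow (insert i I). \<rho> ^ card S * c S * walsh S A) =
      (\<Sum>S\<in>Pow I. \<rho> ^ card S * c S * walsh S A) +
      \<rho> * signum_at A i * (\<Sum>S\<in>Pow I. \<rho> ^ card S * c (insert i S) * walsh S A)" for A
    unfolding sum_Pow_insert[OF insert.hyps] sum.distrib
    by (simp add: w2 card sum_distrib_left mult_ac)
  have val1: "(\<Sum>S\<in>Pow (insert i I). \<rho> ^ card S * c S * walsh S A) = p A + \<rho> * q A"
    and val2: "(\<Sum>S\<in>Pow (insert i I). \<rho> ^ card S * c S * walsh S (insert i A)) = p A - \<rho> * q A"
    if "A \<subseteq> I" for A
    using that insert.hyps by (auto simp: val p_def q_def signum_at_def w1)
  have "cube_mean (insert i I) (\<lambda>A. (\<Sum>S\<in>Pow (insert i I). \<rho> ^ card S * c S * walsh S A) ^ 4) =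
      (\<Sum>A\<in>Pow I. (p A + \<rho> * q A) ^ 4 + (p A - \<rho> * q A) ^ 4) / 2 ^ card (insert i I)"
    unfolding cube_mean_def
    by (subst sum_Pow_insert[OF insert.hyps], intro arg_cong2[where f = "(/)"] sum.cong refl)
      (simp only: val1 val2 Pow_iff)
  also have "\<dots> = cube_mean I (\<lambda>A. ((p A + \<rho> * q A) ^ 4 + (p A - \<rho> * q A) ^ 4) / 2)"
    using insert.hyps by (simp add: cube_mean_def sum_divide_distrib)
  also have "(\<lambda>A. ((p A + \<rho> * q A) ^ 4 + (p A - \<rho> * q A) ^ 4) / 2) =
      (\<lambda>A. p A ^ 4 + 2 * ((p A)\<^sup>2 * (q A)\<^sup>2) + 1 / 9 * q A ^ 4)"
  proof
    fix A
    have "((p A + \<rho> * q A) ^ 4 + (p A - \<rho> * q A) ^ 4) / 2 =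
        p A ^ 4 + 6 * \<rho>\<^sup>2 * ((p A)\<^sup>2 * (q A)\<^sup>2) + (\<rho>\<^sup>2)\<^sup>2 * q A ^ 4"
      by (simp add: field_simps power2_eq_square power4_eq_xxxx)
    then show "((p A + \<rho> * q A) ^ 4 + (p A - \<rho> * q A) ^ 4) / 2 =
        p A ^ 4 + 2 * ((p A)\<^sup>2 * (q A)\<^sup>2) + 1 / 9 * q A ^ 4"
      unfolding \<rho>2 by (simp add: power2_eq_square)
  qed
  also have "cube_mean I \<dots> = cube_mean I (\<lambda>A. p A ^ 4) + 2 * cube_mean I (\<lambda>A. (p A)\<^sup>2 * (q A)\<^sup>2)
      + 1 / 9 * cube_mean I (\<lambda>A. q A ^ 4)"
    by (simp only: cube_mean_add cube_mean_cmult)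
  also have "\<dots> \<le> a\<^sup>2 + 2 * (a * b) + b\<^sup>2"
    using p4 q4 pq zero_le_power2[of b] by linarith
  also have "\<dots> = (\<Sum>S\<in>Pow (insert i I). (c S)\<^sup>2)\<^sup>2"
    unfolding sum_Pow_insert[OF insert.hyps] sum.distrib a_def b_def by (simp add: power2_sum)
  finally show ?case
    unfolding \<rho>_def .
qed

section \<open>The Kahn-Kalai-Linial inequality\<close>

text \<open>The absolute difference, rather than its square, makes influence additive over the cut
  decomposition of a real function. For indicator functions the two agree.\<close>

definition influence :: "'a set \<Rightarrow> ('a set \<Rightarrow> real) \<Rightarrow> 'a \<Rightarrow> real" where
  "influence I f i = cube_mean I (\<lambda>A. \<bar>f A - f (sym_diff A {i})\<bar>)"

lemma influence_nonneg: "0 \<le> influence I f i"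
  unfolding influence_def by (rule cube_mean_nonneg) simp

lemma fourier_flip_diff:
  assumes "finite I" "i \<in> I" "S \<subseteq> I"
  shows "fourier I (\<lambda>A. f A - f (sym_diff A {i})) S = (if i \<in> S then 2 * fourier I f S else 0)"
proof -
  have S: "finite S"
    using assms finite_subset by blast
  have invol: "sym_diff (sym_diff A {i}) {i} = A" for A
    by auto
  have "cube_mean I (\<lambda>A. f (sym_diff A {i}) * walsh S A)
      = cube_mean I (\<lambda>A. f A * walsh S (sym_diff A {i}))"
    using cube_mean_reindex[OF bij_betw_flip[OF assms(2)],
        of "\<lambda>A. f A * walsh S (sym_diff A {i})"] by (simp only: invol)
  also have "\<dots> = (if i \<in> S then - 1 else 1) * fourier I f S"
    unfolding fourier_def by (subst cube_mean_cmult[symmetric]) (simp add: walsh_flip[OF S])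
  finally show ?thesis
    by (simp add: fourier_def left_diff_distrib cube_mean_diff)
qed

text \<open>Duality with Bonami's inequality, Hoelder's inequality being replaced by two applications of
  Cauchy-Schwarz since \<open>g ^ 3 = g\<close>.\<close>

lemma hypercontractive_dual:
  assumes "finite I" and g: "\<And>A. A \<subseteq> I \<Longrightarrow> g A \<in> {-1, 0, 1}"
  shows "(\<Sum>S\<in>Pow I. (1 / 3) ^ card S * (fourier I g S)\<^sup>2)\<^sup>2 \<le> (cube_mean I (\<lambda>A. \<bar>g A\<bar>)) ^ 3"
proof -
  define \<rho> :: real where "\<rho> = 1 / sqrt 3"
  \<comment> \<open>\<open>P\<close> is \<open>g\<close> with noise of parameter
    \<open>1 / 3\<close>. One factor \<open>\<rho> ^ card S\<close> is kept for Bonami's inequality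
    and the other is counted as part of the coefficient, so both the fourth moment bound and the
    pairing of \<open>P\<close> with \<open>g\<close> are expressed through
    \<open>a\<close>.\<close>
  define P where "P A = (\<Sum>S\<in>Pow I. \<rho> ^ card S * (\<rho> ^ card S * fourier I g S) * walsh S A)" for A
  define a where "a = (\<Sum>S\<in>Pow I. (1 / 3) ^ card S * (fourier I g S)\<^sup>2)"
  define m where "m = cube_mean I (\<lambda>A. \<bar>g A\<bar>)"
  have \<rho>2: "\<rho> ^ n * \<rho> ^ n = (1 / 3) ^ n" for n
    by (simp add: \<rho>_def flip: power_mult_distrib)
  have a0: "a \<ge> 0" and m0: "m \<ge> 0"
    by (auto simp: a_def m_def intro!: sum_nonneg cube_mean_nonneg)
  have "cube_mean I (\<lambda>A. P A ^ 4) \<le> (\<Sum>S\<in>Pow I. (\<rho> ^ card S * fourier I g S)\<^sup>2)\<^sup>2"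
    unfolding P_def \<rho>_def by (rule bonami[OF assms(1)])
  also have "\<dots> = a\<^sup>2"
    unfolding a_def power_mult_distrib by (simp add: power2_eq_square[of "\<rho> ^ _"] \<rho>2)
  finally have P4: "cube_mean I (\<lambda>A. P A ^ 4) \<le> a\<^sup>2" .
  have gP: "cube_mean I (\<lambda>A. g A * P A) = a"
  proof -
    have "g A * P A = (\<Sum>S\<in>Pow I. ((1 / 3) ^ card S * fourier I g S) * (g A * walsh S A))" for A
      by (simp add: P_def sum_distrib_left mult_ac flip: \<rho>2)
    then have "cube_mean I (\<lambda>A. g A * P A) = (\<Sum>S\<in>Pow I. (1 / 3) ^ card S * fourier I g S * fourier I g S)"
      by (simp add: cube_mean_sum cube_mean_cmult fourier_def)
    then show ?thesis
      by (simp add: a_def power2_eq_square mult_ac)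
  qed
  have g_pow: "g A * ((g A)\<^sup>2 * x) = g A * x" "(g A)\<^sup>2 = \<bar>g A\<bar>" "((g A)\<^sup>2)\<^sup>2 = \<bar>g A\<bar>"
    if "A \<subseteq> I" for A x
    using g[OF that] by auto
  have "a\<^sup>2 = (cube_mean I (\<lambda>A. g A * ((g A)\<^sup>2 * P A)))\<^sup>2"
    unfolding gP[symmetric]
    by (intro arg_cong[where f = "\<lambda>x. x\<^sup>2"] cube_mean_cong) (simp only: g_pow(1))
  also have "\<dots> \<le> cube_mean I (\<lambda>A. (g A)\<^sup>2) * cube_mean I (\<lambda>A. ((g A)\<^sup>2 * P A)\<^sup>2)"
    by (rule cube_mean_Cauchy_Schwarz)
  also have "cube_mean I (\<lambda>A. (g A)\<^sup>2) = m"
    unfolding m_def by (intro cube_mean_cong) (rule g_pow(2))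
  also have "cube_mean I (\<lambda>A. ((g A)\<^sup>2 * P A)\<^sup>2) = cube_mean I (\<lambda>A. (g A)\<^sup>2 * (P A)\<^sup>2)"
    by (intro cube_mean_cong) (simp only: g_pow(3) power_mult_distrib abs_power2, simp only: g_pow(2))
  finally have 1: "a\<^sup>2 \<le> m * cube_mean I (\<lambda>A. (g A)\<^sup>2 * (P A)\<^sup>2)" .
  have "(cube_mean I (\<lambda>A. (g A)\<^sup>2 * (P A)\<^sup>2))\<^sup>2 \<le>
      cube_mean I (\<lambda>A. ((g A)\<^sup>2)\<^sup>2) * cube_mean I (\<lambda>A. ((P A)\<^sup>2)\<^sup>2)"
    by (rule cube_mean_Cauchy_Schwarz)
  also have "cube_mean I (\<lambda>A. ((g A)\<^sup>2)\<^sup>2) = m"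
    unfolding m_def by (intro cube_mean_cong) (rule g_pow(3))
  also have "m * cube_mean I (\<lambda>A. ((P A)\<^sup>2)\<^sup>2) \<le> m * a\<^sup>2"
    using P4 m0 by (intro mult_left_mono) (simp_all flip: power_mult)
  finally have 2: "(cube_mean I (\<lambda>A. (g A)\<^sup>2 * (P A)\<^sup>2))\<^sup>2 \<le> m * a\<^sup>2" .
  have "(a\<^sup>2)\<^sup>2 \<le> (m * cube_mean I (\<lambda>A. (g A)\<^sup>2 * (P A)\<^sup>2))\<^sup>2"
    using 1 by (intro power_mono) auto
  also have "\<dots> \<le> m\<^sup>2 * (m * a\<^sup>2)"
    using 2 by (simp add: power_mult_distrib mult_left_mono)
  finally have "a\<^sup>2 * a\<^sup>2 \<le> m ^ 3 * a\<^sup>2"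
    by (simp add: power2_eq_square power3_eq_cube mult_ac)
  then have "a\<^sup>2 \<le> m ^ 3"
    using m0 mult_right_le_imp_le[of "a\<^sup>2" "a\<^sup>2" "m ^ 3"] by (cases "a = 0") simp_all
  then show ?thesis
    by (simp add: a_def m_def)
qed

text \<open>The discrete derivative of an indicator takes values in \<open>{-1, 0, 1}\<close>, so
  its first and second moments coincide. Parseval then gives the equation. The second claim bounds
  the noisy version by the power \<open>3 / 2\<close> of the influence, which is a real gain when
  the influence is small.\<close>

lemma influence_spectral:
  assumes "finite I" "i \<in> I" and f: "\<And>A. A \<subseteq> I \<Longrightarrow> f A \<in> {0, 1}"
  shows "influence I f i = 4 * (\<Sum>S\<in>Pow I. of_bool (i \<in> S) * (fourier I f S)\<^sup>2)"
    and "(4 * (\<Sum>S\<in>Pow I. of_bool (i \<in> S) * ((1 / 3) ^ card S * (fourier I f S)\<^sup>2)))\<^sup>2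
      \<le> influence I f i ^ 3"
proof -
  define g where "g A = f A - f (sym_diff A {i})" for A
  have g: "g A \<in> {-1, 0, 1}" if "A \<subseteq> I" for A
  proof -
    have "sym_diff A {i} \<subseteq> I"
      using that assms by auto
    from f[OF that] f[OF this] show ?thesis
      by (auto simp: g_def)
  qed
  have fg: "fourier I g S = (if i \<in> S then 2 * fourier I f S else 0)" if "S \<in> Pow I" for S
    unfolding g_def using that by (intro fourier_flip_diff assms) auto
  have "influence I f i = cube_mean I (\<lambda>A. (g A)\<^sup>2)"
    unfolding influence_def g_def[symmetric]
  proof (rule cube_mean_cong)
    show "\<bar>g A\<bar> = (g A)\<^sup>2" if "A \<subseteq> I" for A
      using g[OF that] by auto
  qed
  also have "\<dots> = (\<Sum>S\<in>Pow I. (fourier I g S)\<^sup>2)"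
    by (rule parseval[OF assms(1), symmetric])
  also have "\<dots> = 4 * (\<Sum>S\<in>Pow I. of_bool (i \<in> S) * (fourier I f S)\<^sup>2)"
    unfolding sum_distrib_left by (intro sum.cong) (auto simp: fg)
  finally show "influence I f i = 4 * (\<Sum>S\<in>Pow I. of_bool (i \<in> S) * (fourier I f S)\<^sup>2)" .
  have "(\<Sum>S\<in>Pow I. (1 / 3) ^ card S * (fourier I g S)\<^sup>2)
      = 4 * (\<Sum>S\<in>Pow I. of_bool (i \<in> S) * ((1 / 3) ^ card S * (fourier I f S)\<^sup>2))"
    unfolding sum_distrib_left by (intro sum.cong) (auto simp: fg)
  moreover have "cube_mean I (\<lambda>A. \<bar>g A\<bar>) = influence I f i"
    by (simp add: g_def influence_def)
  ultimately show "(4 * (\<Sum>S\<in>Pow I. of_bool (i \<in> S) * ((1 / 3) ^ card S * (fourier I f S)\<^sup>2)))\<^sup>2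
      \<le> influence I f i ^ 3"
    using hypercontractive_dual[OF assms(1), of g] g by simp
qed

lemma cube_of_nat_le_8_power: "real D ^ 3 \<le> 8 ^ D"
proof -
  have "real D \<le> 2 ^ D"
    by (metis less_exp less_imp_le of_nat_le_numeral_power_cancel_iff)
  then have "real D ^ 3 \<le> (2 ^ D) ^ 3"
    by (intro power_mono) auto
  also have "\<dots> = (2 ^ 3) ^ D"
    by (simp only: mult.commute flip: power_mult)
  finally show ?thesis
    by simp
qed

text \<open>The Kahn-Kalai-Linial argument: Fourier levels above \<open>D\<close> are controlled by the total influence
  \<open>T\<close>, the lower ones by hypercontractivity, since no influence exceeds \<open>T / M\<close>.\<close>

lemma kkl_variance:
  assumes I: "finite I" and f: "\<And>A. A \<subseteq> I \<Longrightarrow> f A \<in> {0, 1}"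
    and small: "\<And>i. i \<in> I \<Longrightarrow> M * influence I f i \<le> (\<Sum>j\<in>I. influence I f j)"
    and M: "128 ^ D \<le> M" and D: "D > 0"
  shows "2 * real D * (cube_mean I f - (cube_mean I f)\<^sup>2) \<le> (\<Sum>i\<in>I. influence I f i)"
proof -
  define T where "T = (\<Sum>i\<in>I. influence I f i)"
  define w where "w S = (fourier I f S)\<^sup>2" for S
  define W where "W = (\<Sum>S\<in>Pow I. of_nat (card S) * ((1 / 3) ^ card S * w S))"
  define V where "V = cube_mean I f - (cube_mean I f)\<^sup>2"
  have w0: "w S \<ge> 0" for S
    by (simp add: w_def)
  have M0: "M > 0"
    using M less_le_trans[of 0 "128 ^ D" M] by simp
  have T0: "T \<ge> 0"
    by (auto simp: T_def intro!: sum_nonneg influence_nonneg)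
  have card_sum: "(\<Sum>i\<in>I. of_bool (i \<in> S)) = real (card S)" if "S \<in> Pow I" for S
    using that I by (simp add: of_bool_def sum.If_cases Int_absorb1)
  have swap: "(\<Sum>i\<in>I. 4 * (\<Sum>S\<in>Pow I. of_bool (i \<in> S) * h S)) =
      4 * (\<Sum>S\<in>Pow I. of_nat (card S) * h S)" for h :: "_ \<Rightarrow> real"
  proof -
    have "(\<Sum>i\<in>I. \<Sum>S\<in>Pow I. of_bool (i \<in> S) * h S) = (\<Sum>S\<in>Pow I. (\<Sum>i\<in>I. of_bool (i \<in> S)) * h S)"
      unfolding sum_distrib_right by (rule sum.swap)
    also have "\<dots> = (\<Sum>S\<in>Pow I. of_nat (card S) * h S)"
      by (intro sum.cong refl) (simp add: card_sum)
    finally show ?thesis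
      by (simp flip: sum_distrib_left)
  qed
  have T_eq: "T = 4 * (\<Sum>S\<in>Pow I. of_nat (card S) * w S)"
    unfolding T_def swap[symmetric] w_def by (intro sum.cong refl influence_spectral(1)[OF I _ f])
  \<comment> \<open>Each term is at most the power \<open>3 / 2\<close> of an influence; one factor
    sums to \<open>T\<close>, and the square root of the other is at most
    \<open>sqrt (T / M)\<close>.\<close>
  have W_le: "4 * W \<le> T * sqrt (T / M)"
  proof -
    have "4 * (\<Sum>S\<in>Pow I. of_bool (i \<in> S) * ((1 / 3) ^ card S * w S)) \<le> influence I f i * sqrt (T / M)"
      if i: "i \<in> I" for i
    proof (rule power2_le_imp_le)
      have "(4 * (\<Sum>S\<in>Pow I. of_bool (i \<in> S) * ((1 / 3) ^ card S * w S)))\<^sup>2 \<le> influence I f i ^ 3"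
        unfolding w_def by (rule influence_spectral(2)[OF I i f])
      also have "\<dots> = (influence I f i)\<^sup>2 * influence I f i"
        by (simp add: power2_eq_square power3_eq_cube)
      also have "\<dots> \<le> (influence I f i)\<^sup>2 * (T / M)"
        using small[OF i] M0 by (intro mult_left_mono) (auto simp: T_def field_simps)
      also have "\<dots> = (influence I f i * sqrt (T / M))\<^sup>2"
        using T0 M0 by (simp add: power_mult_distrib)
      finally show "(4 * (\<Sum>S\<in>Pow I. of_bool (i \<in> S) * ((1 / 3) ^ card S * w S)))\<^sup>2
        \<le> (influence I f i * sqrt (T / M))\<^sup>2" .
    qed (use T0 M0 influence_nonneg[of I f i] in simp)
    then have "(\<Sum>i\<in>I. 4 * (\<Sum>S\<in>Pow I. of_bool (i \<in> S) * ((1 / 3) ^ card S * w S)))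
        \<le> (\<Sum>i\<in>I. influence I f i * sqrt (T / M))"
      by (rule sum_mono)
    then show ?thesis
      unfolding swap W_def T_def by (simp only: sum_distrib_right)
  qed
  have V_eq: "V = (\<Sum>S\<in>Pow I - {{}}. w S)"
  proof -
    have "(\<Sum>S\<in>Pow I. w S) = cube_mean I (\<lambda>A. (f A)\<^sup>2)"
      unfolding w_def by (rule parseval[OF I])
    also have "\<dots> = cube_mean I f"
    proof (rule cube_mean_cong)
      show "(f A)\<^sup>2 = f A" if "A \<subseteq> I" for A
        using f[OF that] by auto
    qed
    finally have "cube_mean I f = w {} + (\<Sum>S\<in>Pow I - {{}}. w S)"
      using I by (subst (asm) sum.remove[of _ "{}"]) auto
    moreover have "w {} = (cube_mean I f)\<^sup>2"
      by (simp add: w_def fourier_def walsh_def)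
    ultimately show ?thesis
      unfolding V_def by linarith
  qed
  have V_le: "V \<le> 1 / 4"
    unfolding V_def using zero_le_power2[of "cube_mean I f - 1 / 2"]
    by (simp add: power2_diff power_divide)
  \<comment> \<open>Levels \<open>card S \<ge> D\<close> are covered by the first summand. Below
    \<open>D\<close>, the noise factor costs at most \<open>3 ^ D\<close>, which the second summand
    restores.\<close>
  have "V \<le> (\<Sum>S\<in>Pow I - {{}}. of_nat (card S) * w S / D + 3 ^ D * (of_nat (card S) * ((1 / 3) ^ card S * w S)))"
    unfolding V_eq
  proof (rule sum_mono)
    fix S
    assume S: "S \<in> Pow I - {{}}"
    then have c1: "card S \<ge> 1"
      using I by (auto simp: Suc_le_eq card_gt_0_iff intro: finite_subset)
    have nonneg: "0 \<le> of_nat (card S) * w S / D" "0 \<le> 3 ^ D * (of_nat (card S) * ((1 / 3) ^ card S * w S))"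
      using w0[of S] by auto
    show "w S \<le> of_nat (card S) * w S / D + 3 ^ D * (of_nat (card S) * ((1 / 3) ^ card S * w S))"
    proof (cases "card S \<ge> D")
      case True
      then have "w S \<le> of_nat (card S) * w S / D"
        using D mult_right_mono[OF _ w0[of S], of "real D" "real (card S)"] by (simp add: field_simps)
      then show ?thesis
        using nonneg(2) by linarith
    next
      case False
      have "(1::real) \<le> 3 ^ (D - card S)"
        by simp
      also have "\<dots> = 3 ^ D * (1 / 3) ^ card S"
        using False by (simp add: power_diff power_divide)
      also have "\<dots> \<le> of_nat (card S) * (3 ^ D * (1 / 3) ^ card S)"
        using c1 by simp
      finally have "1 * w S \<le> of_nat (card S) * (3 ^ D * (1 / 3) ^ card S) * w S"
        by (intro mult_right_mono w0)
      then show ?thesis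
        using nonneg(1) by (simp add: mult_ac)
    qed
  qed
  also have "\<dots> \<le> (\<Sum>S\<in>Pow I. of_nat (card S) * w S / D + 3 ^ D * (of_nat (card S) * ((1 / 3) ^ card S * w S)))"
    using I w0 by (intro sum_mono2) auto
  also have "\<dots> = T / (4 * D) + 3 ^ D * W"
    unfolding sum.distrib T_eq W_def sum_distrib_left by (simp add: sum_divide_distrib)
  finally have V1: "4 * D * V \<le> T + D * 3 ^ D * (4 * W)"
    using D by (simp add: field_simps)
  have "2 * D * V \<le> T"
  proof (rule ccontr)
    assume "\<not> 2 * D * V \<le> T"
    then have less: "T < 2 * D * V"
      by simp
    also have "\<dots> \<le> D / 2"
      using V_le D by (simp add: field_simps)
    finally have TD: "T \<le> D / 2"
      by simp
    \<comment> \<open>After squaring, and with \<open>T \<le> D / 2\<close>, the requirement is that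
      \<open>M\<close> dominates \<open>D ^ 3 * 9 ^ D\<close>, which is at most
      \<open>72 ^ D\<close>; 128 is the next power of two above 72.\<close>
    have "D * 3 ^ D * sqrt (T / M) \<le> 1"
    proof (rule power2_le_imp_le)
      have "real D ^ 3 * 9 ^ D \<le> 8 ^ D * 9 ^ D"
        by (intro mult_right_mono cube_of_nat_le_8_power) auto
      also have "\<dots> = 72 ^ D"
        by (simp flip: power_mult_distrib)
      also have "\<dots> \<le> 128 ^ D"
        by (intro power_mono) auto
      finally have DM: "real D ^ 3 * 9 ^ D \<le> M"
        using M by simp
      have "(D * 3 ^ D * sqrt (T / M))\<^sup>2 = D\<^sup>2 * 9 ^ D * T / M"
      proof -
        have "(3 ^ D)\<^sup>2 = (9 :: real) ^ D"
          unfolding power2_eq_square by (simp flip: power_mult_distrib)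
        then show ?thesis
          using T0 M0 by (simp add: power_mult_distrib[of _ "sqrt _"] power_mult_distrib[of "real D"])
      qed
      also have "\<dots> \<le> D\<^sup>2 * 9 ^ D * (D / 2) / M"
        using TD M0 by (intro divide_right_mono mult_left_mono) auto
      also have "\<dots> = (real D ^ 3 * 9 ^ D) / M / 2"
        by (simp add: power2_eq_square power3_eq_cube mult_ac)
      also have "\<dots> \<le> 1\<^sup>2"
        using DM M0 by (simp add: field_simps)
      finally show "(D * 3 ^ D * sqrt (T / M))\<^sup>2 \<le> 1\<^sup>2" .
    qed simp
    then have "T * (D * 3 ^ D * sqrt (T / M)) \<le> T * 1"
      using T0 by (intro mult_left_mono)
    moreover have "D * 3 ^ D * (4 * W) \<le> D * 3 ^ D * (T * sqrt (T / M))"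
      using W_le by (intro mult_left_mono) auto
    ultimately have "4 * D * V \<le> 2 * T"
      using V1 by (simp add: mult_ac)
    with less show False
      by simp
  qed
  then show ?thesis
    by (simp add: V_def T_def)
qed

text \<open>Two independent points are separated by a cut of density \<open>p\<close> with
  probability \<open>2 * p * (1 - p)\<close>.\<close>

lemma cube_mean_abs_diff_indicator:
  assumes "finite I" and f: "\<And>A. A \<subseteq> I \<Longrightarrow> f A \<in> {0, 1}"
  shows "cube_mean I (\<lambda>A. cube_mean I (\<lambda>B. \<bar>f A - f B\<bar>)) = 2 * (cube_mean I f - (cube_mean I f)\<^sup>2)"
proof -
  have "cube_mean I (\<lambda>B. \<bar>f A - f B\<bar>) = cube_mean I f + (1 - 2 * cube_mean I f) * f A" if "A \<subseteq> I" for A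
  proof -
    have "cube_mean I (\<lambda>B. \<bar>f A - f B\<bar>) = cube_mean I (\<lambda>B. f A + (1 - 2 * f A) * f B)"
    proof (rule cube_mean_cong)
      fix B
      assume "B \<subseteq> I"
      from f[OF that] f[OF this] show "\<bar>f A - f B\<bar> = f A + (1 - 2 * f A) * f B"
        by auto
    qed
    also have "\<dots> = f A + (1 - 2 * f A) * cube_mean I f"
      by (simp only: cube_mean_add cube_mean_cmult cube_mean_const[OF assms(1)])
    finally show ?thesis
      by (simp add: algebra_simps)
  qed
  then have "cube_mean I (\<lambda>A. cube_mean I (\<lambda>B. \<bar>f A - f B\<bar>))
      = cube_mean I (\<lambda>A. cube_mean I f + (1 - 2 * cube_mean I f) * f A)"
    by (rule cube_mean_cong)
  also have "\<dots> = cube_mean I f + (1 - 2 * cube_mean I f) * cube_mean I f"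
    by (simp only: cube_mean_add cube_mean_cmult cube_mean_const[OF assms(1)])
  finally show ?thesis
    by (simp add: algebra_simps power2_eq_square)
qed

lemma layer_cake_abs_diff:
  fixes a b :: real
  shows "has_bochner_integral lborel (\<lambda>t. \<bar>of_bool (t < a) - of_bool (t < b)\<bar>) \<bar>a - b\<bar>"
proof -
  have *: "has_bochner_integral lborel (indicator {c..<d} :: real \<Rightarrow> real) (d - c)" if "c \<le> d" for c d :: real
    using has_bochner_integral_real_indicator[of "{c..<d}" lborel] that by simp
  have "(\<lambda>t. \<bar>of_bool (t < a) - of_bool (t < b)\<bar>) = (indicator {min a b..<max a b} :: real \<Rightarrow> real)"
    by (auto simp: fun_eq_iff indicator_def)
  then show ?thesis
    using *[of "min a b" "max a b"] by (simp only: max_def min_def) (cases "a \<le> b"; simp)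
qed

lemma has_bochner_integral_cube_mean:
  assumes "\<And>A. A \<subseteq> I \<Longrightarrow> has_bochner_integral M (\<lambda>t. f t A) (g A)"
  shows "has_bochner_integral M (\<lambda>t. cube_mean I (f t)) (cube_mean I g)"
  unfolding cube_mean_def using assms
  by (intro has_bochner_integral_divide_zero has_bochner_integral_sum) auto

text \<open>The cut decomposition of the line metric transfers an inequality from indicator functions to
  real functions.\<close>

lemma kkl_real:
  assumes I: "finite I" and D: "D > 0" and M: "128 ^ D \<le> M"
    and small: "\<And>t i. i \<in> I \<Longrightarrow> M * influence I (\<lambda>A. of_bool (t < F A)) i
      \<le> (\<Sum>j\<in>I. influence I (\<lambda>A. of_bool (t < F A)) j)"
  shows "real D * cube_mean I (\<lambda>A. cube_mean I (\<lambda>B. \<bar>F A - F B\<bar>)) \<le> (\<Sum>i\<in>I. influence I F i)"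
proof -
  define l r where "l t = real D * cube_mean I (\<lambda>A. cube_mean I (\<lambda>B. \<bar>of_bool (t < F A) - of_bool (t < F B)\<bar>))"
    and "r t = (\<Sum>i\<in>I. influence I (\<lambda>A. of_bool (t < F A)) i)" for t
  have l: "has_bochner_integral lborel l (real D * cube_mean I (\<lambda>A. cube_mean I (\<lambda>B. \<bar>F A - F B\<bar>)))"
    unfolding l_def
    by (intro has_bochner_integral_mult_right has_bochner_integral_cube_mean layer_cake_abs_diff)
  have r: "has_bochner_integral lborel r (\<Sum>i\<in>I. influence I F i)"
    unfolding r_def influence_def
    by (intro has_bochner_integral_sum has_bochner_integral_cube_mean layer_cake_abs_diff)
  have le: "l t \<le> r t" for t
  proof -
    have "l t = 2 * real D * (cube_mean I (\<lambda>A. of_bool (t < F A)) - (cube_mean I (\<lambda>A. of_bool (t < F A)))\<^sup>2)"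
      unfolding l_def by (subst cube_mean_abs_diff_indicator[OF I]) auto
    also have "\<dots> \<le> r t"
      unfolding r_def by (rule kkl_variance[OF I _ small M D]) auto
    finally show ?thesis .
  qed
  show ?thesis
    using integral_mono[of lborel l r] l r le by (metis has_bochner_integral_iff)
qed

section \<open>Powers of correlations\<close>

lemma add_power_le:
  fixes a b :: real
  assumes "0 \<le> a" "0 \<le> b"
  shows "(a + b) ^ n \<le> 2 ^ n * (a ^ n + b ^ n)"
proof -
  have "(a + b) ^ n \<le> (2 * max a b) ^ n"
    using assms by (intro power_mono) auto
  also have "\<dots> = 2 ^ n * max a b ^ n"
    by (rule power_mult_distrib)
  also have "max a b ^ n \<le> a ^ n + b ^ n"
    using assms by (simp add: max_def)
  finally show ?thesis
    by simp
qed

lemma power_diff_le: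
  fixes a b v :: real
  assumes "0 \<le> a" "0 \<le> b" "0 \<le> v" "a - v \<le> b"
  shows "a ^ Suc n - b ^ Suc n \<le> real (Suc n) * v * a ^ n"
proof (cases "a \<le> b")
  case True
  then have "a ^ Suc n \<le> b ^ Suc n"
    using assms by (intro power_mono) auto
  then show ?thesis
    using assms by (smt (verit) mult_nonneg_nonneg of_nat_0_le_iff zero_le_power)
next
  case False
  have "(\<Sum>i<Suc n. b ^ (Suc n - Suc i) * a ^ i) \<le> (\<Sum>i<Suc n. a ^ (Suc n - Suc i) * a ^ i)"
    using False assms by (intro sum_mono mult_right_mono power_mono) auto
  also have "\<dots> = (\<Sum>i<Suc n. a ^ n)"
    by (intro sum.cong refl) (auto simp flip: power_add)
  finally have *: "(\<Sum>i<Suc n. b ^ (Suc n - Suc i) * a ^ i) \<le> real (Suc n) * a ^ n"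
    by simp
  have "a ^ Suc n - b ^ Suc n = (a - b) * (\<Sum>i<Suc n. b ^ (Suc n - Suc i) * a ^ i)"
    by (rule power_diff_sumr2)
  also have "\<dots> \<le> v * (real (Suc n) * a ^ n)"
    using * False assms by (intro mult_mono sum_nonneg mult_nonneg_nonneg zero_le_power) auto
  finally show ?thesis
    by (simp add: mult_ac)
qed

text \<open>Subadditivity of \<open>1 - (1 - u) ^ p\<close>, with a quantitative surplus. For
  \<open>p = 2\<close> the two sides without the term \<open>u * v\<close> differ by exactly
  \<open>2 * u * v\<close>; raising the exponent multiplies each power by its base, and since
  \<open>s\<close> is at most \<open>x\<close> and \<open>y\<close> this does not eat into the
  surplus.\<close>

lemma power_supermodular:
  fixes u v :: real
  assumes "0 \<le> u" "0 \<le> v" "u + v \<le> 1"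
  shows "(1 - u) ^ (n + 2) + (1 - v) ^ (n + 2) + u * v \<le> 1 + (1 - u - v) ^ (n + 2)"
proof (induction n)
  case 0
  show ?case
    using assms by (simp add: power2_eq_square algebra_simps)
next
  case (Suc n)
  define s x y where "s = (1 - u - v) ^ (n + 2)" and "x = (1 - u) ^ (n + 2)" and "y = (1 - v) ^ (n + 2)"
  have "s \<le> x" "s \<le> y"
    unfolding s_def x_def y_def using assms by (intro power_mono; simp)+
  then have "s * u \<le> x * u" "s * v \<le> y * v"
    using assms by (auto intro: mult_right_mono)
  moreover have "x + y + u * v \<le> 1 + s"
    using Suc unfolding s_def x_def y_def .
  ultimately have "(1 - u) * x + (1 - v) * y + u * v \<le> 1 + (1 - u - v) * s"
    by (simp add: algebra_simps)
  then show ?case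
    by (simp add: s_def x_def y_def)
qed

text \<open>By \<open>pair\<close>, every correlation other than the one at \<open>g0\<close> is at
  most \<open>1 - c g0 + \<epsilon>\<close>. Eight of the ten factors are bounded this way and the
  remaining square is summed by \<open>sq\<close>.\<close>

lemma sum_power_10_le:
  fixes c :: "'g \<Rightarrow> real"
  assumes "finite G" "g0 \<in> G" and nonneg: "\<And>g. g \<in> G \<Longrightarrow> 0 \<le> c g"
    and pair: "\<And>g. g \<in> G \<Longrightarrow> g \<noteq> g0 \<Longrightarrow> c g + c g0 \<le> 1 + \<epsilon>"
    and sq: "(\<Sum>g\<in>G. (c g)\<^sup>2) \<le> 2"
    and c1: "c g0 \<le> 1" and \<epsilon>: "0 \<le> \<epsilon>"
  shows "(\<Sum>g\<in>G. c g ^ 10) \<le> c g0 ^ 10 + 2 * (1 - c g0 + \<epsilon>) ^ 8"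
proof -
  have "(\<Sum>g\<in>G - {g0}. c g ^ 10) \<le> (\<Sum>g\<in>G - {g0}. (c g)\<^sup>2 * (1 - c g0 + \<epsilon>) ^ 8)"
  proof (rule sum_mono)
    fix g
    assume g: "g \<in> G - {g0}"
    have "c g ^ 10 = (c g)\<^sup>2 * c g ^ 8"
      by (simp flip: power_add)
    also have "\<dots> \<le> (c g)\<^sup>2 * (1 - c g0 + \<epsilon>) ^ 8"
      using nonneg[of g] pair[of g] g by (intro mult_left_mono power_mono) auto
    finally show "c g ^ 10 \<le> (c g)\<^sup>2 * (1 - c g0 + \<epsilon>) ^ 8" .
  qed
  also have "\<dots> = (\<Sum>g\<in>G - {g0}. (c g)\<^sup>2) * (1 - c g0 + \<epsilon>) ^ 8"
    by (simp add: sum_distrib_right)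
  also have "\<dots> \<le> 2 * (1 - c g0 + \<epsilon>) ^ 8"
  proof (rule mult_right_mono)
    have "(\<Sum>g\<in>G - {g0}. (c g)\<^sup>2) \<le> (\<Sum>g\<in>G. (c g)\<^sup>2)"
      using assms(1) by (intro sum_mono2) auto
    then show "(\<Sum>g\<in>G - {g0}. (c g)\<^sup>2) \<le> 2"
      using sq by linarith
  qed simp
  finally have "(\<Sum>g\<in>G - {g0}. c g ^ 10) \<le> 2 * (1 - c g0 + \<epsilon>) ^ 8" .
  then show ?thesis
    using assms(1,2) by (simp add: sum.remove[of G g0])
qed

text \<open>The triangle inequality for \<open>1 + \<sigma> - \<Sum>\<^sub>g \<bar>\<langle>x, g y\<rangle>\<bar>\<^sup>1\<^sup>0\<close>: \<open>a\<close>, \<open>b\<close>, \<open>c\<close> are the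
  correlations of \<open>x\<close> with the orbit of \<open>y\<close>, of \<open>z\<close> with the orbit of \<open>y\<close>, and of \<open>x\<close> with the orbit
  of \<open>z\<close>. When \<open>y\<close> is also close to \<open>x\<close>, the gain \<open>u * v\<close> from the two dominant correlations pays for
  all the others.\<close>

lemma orbit_kernel_triangle:
  fixes a b c :: "'g \<Rightarrow> real"
  assumes G: "finite G" "g0 \<in> G" "g1 \<in> G"
    and a: "\<And>g. g \<in> G \<Longrightarrow> 0 \<le> a g" "\<And>g. g \<in> G \<Longrightarrow> a g \<le> a g1"
    and b: "\<And>g. g \<in> G \<Longrightarrow> 0 \<le> b g"
    and c: "\<And>g. g \<in> G \<Longrightarrow> 0 \<le> c g" "\<And>g. g \<in> G \<Longrightarrow> c g \<le> c g0" "c g0 \<le> 1"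
    and ac: "a g1 \<le> c g0"
    and lip: "\<And>g. g \<in> G \<Longrightarrow> a g - (1 - c g0) \<le> b g"
    and pair: "\<And>g. g \<in> G \<Longrightarrow> g \<noteq> g1 \<Longrightarrow> a g + a g1 \<le> 1 + \<epsilon>"
      "\<And>g. g \<in> G \<Longrightarrow> g \<noteq> g0 \<Longrightarrow> c g + c g0 \<le> 1 + \<epsilon>"
    and sq: "(\<Sum>g\<in>G. (a g)\<^sup>2) \<le> 2" "(\<Sum>g\<in>G. (c g)\<^sup>2) \<le> 2"
    and \<epsilon>: "0 \<le> \<epsilon>" "\<epsilon> \<le> 1" and \<sigma>: "3072 * \<epsilon> ^ 7 \<le> \<sigma>"
  shows "(\<Sum>g\<in>G. a g ^ 10) + (\<Sum>g\<in>G. c g ^ 10) \<le> 1 + \<sigma> + (\<Sum>g\<in>G. b g ^ 10)"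
proof -
  define v where "v = 1 - c g0"
  define u where "u = 1 - a g1"
  have v0: "0 \<le> v" and vu: "v \<le> u"
    using c ac by (auto simp: u_def v_def)
  have \<epsilon>8: "\<epsilon> ^ 8 \<le> \<epsilon> ^ 7" and \<epsilon>7: "0 \<le> \<epsilon> ^ 7"
    using \<epsilon> by (auto intro: power_decreasing)
  have \<sigma>0: "0 \<le> \<sigma>"
    using \<sigma> \<epsilon>7 by linarith
  have b_sum: "0 \<le> (\<Sum>g\<in>G. b g ^ 10)"
    using b by (auto intro: sum_nonneg)
  show ?thesis
  \<comment> \<open>There are three regimes. If even the largest correlation is at most
    \<open>3 / 4\<close>, each sum on the left is at most \<open>2 * (3 / 4) ^ 8\<close>, hence at
    most \<open>1 / 2\<close>, and nothing has to be compared.\<close>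
  proof (cases "c g0 \<le> 3 / 4")
    case True
    have half: "(\<Sum>g\<in>G. h g ^ 10) \<le> 1 / 2"
      if h: "\<And>g. g \<in> G \<Longrightarrow> 0 \<le> h g" "\<And>g. g \<in> G \<Longrightarrow> h g \<le> 3 / 4" "(\<Sum>g\<in>G. (h g)\<^sup>2) \<le> 2" for h :: "'g \<Rightarrow> real"
    proof -
      have "(\<Sum>g\<in>G. h g ^ 10) \<le> (\<Sum>g\<in>G. (3 / 4) ^ 8 * (h g)\<^sup>2)"
      proof (rule sum_mono)
        fix g
        assume g: "g \<in> G"
        have "h g ^ 10 = h g ^ 8 * (h g)\<^sup>2"
          by (simp flip: power_add)
        also have "\<dots> \<le> (3 / 4) ^ 8 * (h g)\<^sup>2"
          using h(1,2)[OF g] by (intro mult_right_mono power_mono) auto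
        finally show "h g ^ 10 \<le> (3 / 4) ^ 8 * (h g)\<^sup>2" .
      qed
      also have "\<dots> = (3 / 4) ^ 8 * (\<Sum>g\<in>G. (h g)\<^sup>2)"
        by (simp add: sum_distrib_left)
      also have "\<dots> \<le> (3 / 4) ^ 8 * 2"
        by (intro mult_left_mono h(3)) auto
      also have "\<dots> \<le> 1 / 2"
        by (simp add: power_divide)
      finally show ?thesis .
    qed
    have le: "a g \<le> 3 / 4" "c g \<le> 3 / 4" if "g \<in> G" for g
      using a(2)[OF that] c(2)[OF that] ac True by auto
    have "(\<Sum>g\<in>G. a g ^ 10) \<le> 1 / 2"
      by (rule half[OF a(1) le(1) sq(1)])
    moreover have "(\<Sum>g\<in>G. c g ^ 10) \<le> 1 / 2"
      by (rule half[OF c(1) le(2) sq(2)])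
    ultimately show ?thesis
      using b_sum \<sigma>0 by linarith
  next
    case False
    then have v: "v < 1 / 4"
      by (simp add: v_def)
    have c_sum: "(\<Sum>g\<in>G. c g ^ 10) \<le> (1 - v) ^ 10 + 512 * v ^ 8 + 512 * \<epsilon> ^ 8"
      using sum_power_10_le[of G g0 c \<epsilon>] add_power_le[OF v0 \<epsilon>(1), of 8] G c pair sq \<epsilon>
      by (simp add: v_def)
    \<comment> \<open>Replacing \<open>x\<close> by \<open>z\<close> lowers a correlation by at most
      \<open>v\<close>, hence its tenth power by at most \<open>10 * v * a g ^ 9\<close>. Seven
      factors are bounded by \<open>w\<close> and two are kept for \<open>sq\<close>.\<close>
    have term_le: "a g ^ 10 - b g ^ 10 \<le> 10 * v * w ^ 7 * (a g)\<^sup>2" if "g \<in> G" "a g \<le> w" for g w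
    proof -
      have "a g ^ Suc 9 - b g ^ Suc 9 \<le> real (Suc 9) * v * a g ^ 9"
        using power_diff_le[OF a(1) b v0 _, of g g 9] lip that by (simp add: v_def)
      also have "a g ^ 9 = a g ^ 7 * (a g)\<^sup>2"
        by (simp flip: power_add)
      also have "real (Suc 9) * v * \<dots> \<le> real (Suc 9) * v * (w ^ 7 * (a g)\<^sup>2)"
        using a(1)[OF that(1)] that(2) v0 by (intro mult_left_mono mult_right_mono power_mono) auto
      finally show ?thesis
        by simp
    qed
    have v78: "v ^ 8 \<le> v * (1 / 4) ^ 7"
    proof -
      have "v * v ^ 7 \<le> v * (1 / 4) ^ 7"
        using v v0 by (intro mult_left_mono power_mono) auto
      then show ?thesis
        by (simp flip: power_Suc)
    qed
    show ?thesis
    \<comment> \<open>With only \<open>z\<close> close to \<open>x\<close>, the loss is linear in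
      \<open>v\<close> with a factor below 3. The dominant term of \<open>c\<close> falls short of 1
      by at least \<open>3 * v\<close>, which repeated squaring below establishes, and this covers
      the loss.\<close>
    proof (cases "a g1 \<le> 3 / 4")
      case True
      have "(\<Sum>g\<in>G. a g ^ 10 - b g ^ 10) \<le> (\<Sum>g\<in>G. 10 * v * (3 / 4) ^ 7 * (a g)\<^sup>2)"
        using term_le a(2) True by (intro sum_mono) (metis order_trans)
      also have "\<dots> = 10 * v * (3 / 4) ^ 7 * (\<Sum>g\<in>G. (a g)\<^sup>2)"
        by (simp add: sum_distrib_left)
      also have "\<dots> \<le> 10 * v * (3 / 4) ^ 7 * 2"
        using v0 by (intro mult_left_mono sq) auto
      finally have a_sum: "(\<Sum>g\<in>G. a g ^ 10) - (\<Sum>g\<in>G. b g ^ 10) \<le> 10 * v * (3 / 4) ^ 7 * 2"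
        by (simp add: sum_subtractf)
      have vv: "v * v \<le> v / 4"
        using v v0 mult_left_mono[of v "1 / 4" v] by simp
      have "(1 - v)\<^sup>2 \<le> 1 - 7 / 4 * v"
        using vv by (simp add: power2_eq_square algebra_simps)
      then have "((1 - v)\<^sup>2)\<^sup>2 \<le> (1 - 7 / 4 * v)\<^sup>2"
        using v v0 by (intro power_mono) auto
      also have "\<dots> \<le> 1 - 27 / 10 * v"
        using vv v0 by (simp add: power2_eq_square algebra_simps)
      finally have "(((1 - v)\<^sup>2)\<^sup>2)\<^sup>2 \<le> (1 - 27 / 10 * v)\<^sup>2"
        by (intro power_mono) auto
      also have "\<dots> \<le> 1 - 3 * v"
        using vv v0 by (simp add: power2_eq_square algebra_simps)
      finally have "(1 - v) ^ 8 \<le> 1 - 3 * v"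
        by (simp flip: power_mult)
      moreover have "(1 - v) ^ 10 \<le> (1 - v) ^ 8"
        using v v0 by (intro power_decreasing) auto
      ultimately have "(1 - v) ^ 10 \<le> 1 - 3 * v"
        by linarith
      then have "(\<Sum>g\<in>G. a g ^ 10) + (\<Sum>g\<in>G. c g ^ 10) \<le>
          1 - 3 * v + 512 * (v * (1 / 4) ^ 7) + 10 * v * (3 / 4) ^ 7 * 2 + 512 * \<epsilon> ^ 8 + (\<Sum>g\<in>G. b g ^ 10)"
        using a_sum c_sum v78 by linarith
      also have "\<dots> \<le> 1 + 512 * \<epsilon> ^ 8 + (\<Sum>g\<in>G. b g ^ 10)"
        using v0 by (simp add: power_divide)
      finally show ?thesis
        using \<sigma> \<epsilon>8 \<epsilon>7 by linarith
    next
      case False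
      then have u: "u < 1 / 4" and u0: "0 \<le> u"
        using v0 vu by (auto simp: u_def)
      have "(\<Sum>g\<in>G - {g1}. a g ^ 10 - b g ^ 10) \<le> (\<Sum>g\<in>G - {g1}. 10 * v * (u + \<epsilon>) ^ 7 * (a g)\<^sup>2)"
      proof (rule sum_mono)
        fix g
        assume "g \<in> G - {g1}"
        then show "a g ^ 10 - b g ^ 10 \<le> 10 * v * (u + \<epsilon>) ^ 7 * (a g)\<^sup>2"
          using pair(1)[of g] by (intro term_le) (auto simp: u_def)
      qed
      also have "\<dots> = 10 * v * (u + \<epsilon>) ^ 7 * (\<Sum>g\<in>G - {g1}. (a g)\<^sup>2)"
        by (simp add: sum_distrib_left)
      also have "\<dots> \<le> 10 * v * (u + \<epsilon>) ^ 7 * 2"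
      proof (intro mult_left_mono)
        have "(\<Sum>g\<in>G - {g1}. (a g)\<^sup>2) \<le> (\<Sum>g\<in>G. (a g)\<^sup>2)"
          using G by (intro sum_mono2) auto
        then show "(\<Sum>g\<in>G - {g1}. (a g)\<^sup>2) \<le> 2"
          using sq by linarith
      qed (use v0 u0 \<epsilon> in auto)
      also have "\<dots> \<le> 10 * v * (2 ^ 7 * (u ^ 7 + \<epsilon> ^ 7)) * 2"
        using v0 by (intro mult_left_mono mult_right_mono add_power_le u0 \<epsilon>) auto
      also have "\<dots> = 2560 * (v * u ^ 7) + 2560 * v * \<epsilon> ^ 7"
        by (simp add: algebra_simps)
      also have "\<dots> \<le> 2560 * (u * v * (1 / 4) ^ 6) + 2560 * \<epsilon> ^ 7"
      proof -
        have "(u * v) * u ^ 6 \<le> (u * v) * (1 / 4) ^ 6"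
          using u u0 v0 by (intro mult_left_mono power_mono) auto
        moreover have "(u * v) * u ^ 6 = v * u ^ 7"
          by (simp add: power_Suc[of u 6, simplified] mult_ac)
        moreover have "v * \<epsilon> ^ 7 \<le> 1 * \<epsilon> ^ 7"
          using v \<epsilon>7 by (intro mult_right_mono) auto
        ultimately show ?thesis
          by linarith
      qed
      finally have rest: "(\<Sum>g\<in>G - {g1}. a g ^ 10 - b g ^ 10) \<le> 2560 * (u * v * (1 / 4) ^ 6) + 2560 * \<epsilon> ^ 7" .
      have "(1 - u - v) ^ 10 \<le> b g1 ^ 10"
        using lip[OF G(3)] u v by (intro power_mono) (auto simp: u_def v_def)
      then have top: "a g1 ^ 10 - b g1 ^ 10 + (1 - v) ^ 10 + u * v \<le> 1"
        using power_supermodular[OF u0 v0, of 8] u v by (simp add: u_def)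
      have v8: "v ^ 8 \<le> u * v * (1 / 4) ^ 6"
      proof -
        have "v * v * v ^ 6 \<le> u * v * (1 / 4) ^ 6"
          using v v0 u0 vu by (intro mult_mono power_mono) auto
        then show ?thesis
          by (simp add: power_Suc[symmetric] mult.assoc del: power_Suc)
      qed
      have uv: "0 \<le> u * v"
        using u0 v0 by simp
      have "(\<Sum>g\<in>G. a g ^ 10) - (\<Sum>g\<in>G. b g ^ 10) = a g1 ^ 10 - b g1 ^ 10 + (\<Sum>g\<in>G - {g1}. a g ^ 10 - b g ^ 10)"
        using G by (simp add: sum.remove[of G g1] sum_subtractf)
      \<comment> \<open>The two charges against the surplus \<open>u * v\<close> add up to
        \<open>3072 / 4 ^ 6\<close>, that is \<open>3 / 4\<close> of it. The part free of
        \<open>u\<close> and \<open>v\<close> is at most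
        \<open>(2560 + 512) * \<epsilon> ^ 7\<close>, the origin of 3072.\<close>
      then have "(\<Sum>g\<in>G. a g ^ 10) + (\<Sum>g\<in>G. c g ^ 10) \<le>
          1 + (2560 * (u * v * (1 / 4) ^ 6) + 512 * (u * v * (1 / 4) ^ 6) - u * v)
            + (2560 * \<epsilon> ^ 7 + 512 * \<epsilon> ^ 8) + (\<Sum>g\<in>G. b g ^ 10)"
        using rest top c_sum v8 by linarith
      also have "\<dots> \<le> 1 + (2560 * \<epsilon> ^ 7 + 512 * \<epsilon> ^ 8) + (\<Sum>g\<in>G. b g ^ 10)"
        using uv by (simp add: power_divide)
      finally show ?thesis
        using \<sigma> \<epsilon>8 by linarith
    qed
  qed
qed

section \<open>Kernels and metrics of negative type\<close>

text \<open>Positive semidefiniteness in the form of an explicit Gram factorisation: products of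
  kernels correspond to tensor products of the vectors, sums to concatenation, and the vectors are
  at hand when a metric of negative type is to be exhibited.\<close>

definition gram_kernel :: "'a set \<Rightarrow> ('a \<Rightarrow> 'a \<Rightarrow> real) \<Rightarrow> bool" where
  "gram_kernel X K \<longleftrightarrow>
     (\<exists>m (w :: 'a \<Rightarrow> nat \<Rightarrow> real). \<forall>x\<in>X. \<forall>y\<in>X. K x y = (\<Sum>j<m. w x j * w y j))"

lemma gram_kernelI:
  fixes w :: "'a \<Rightarrow> 'j \<Rightarrow> real"
  assumes "finite J" and K: "\<And>x y. x \<in> X \<Longrightarrow> y \<in> X \<Longrightarrow> K x y = (\<Sum>j\<in>J. w x j * w y j)"
  shows "gram_kernel X K"
proof -
  obtain h where h: "bij_betw h {..<card J} J"
    using ex_bij_betw_nat_finite[OF assms(1)] by (auto simp: atLeast0LessThan)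
  have "K x y = (\<Sum>j<card J. w x (h j) * w y (h j))" if "x \<in> X" "y \<in> X" for x y
    using K[OF that] sum.reindex_bij_betw[OF h, of "\<lambda>j. w x j * w y j"] by simp
  then show ?thesis
    unfolding gram_kernel_def by (intro exI[of _ "card J"] exI[of _ "\<lambda>x j. w x (h j)"]) auto
qed

lemma gram_kernel_mult:
  assumes "gram_kernel X K" "gram_kernel X K'"
  shows "gram_kernel X (\<lambda>x y. K x y * K' x y)"
proof -
  obtain m w where w: "\<And>x y. x \<in> X \<Longrightarrow> y \<in> X \<Longrightarrow> K x y = (\<Sum>j<m. w x j * w y (j::nat))"
    using assms(1) unfolding gram_kernel_def by blast
  obtain m' w' where w': "\<And>x y. x \<in> X \<Longrightarrow> y \<in> X \<Longrightarrow> K' x y = (\<Sum>j<m'. w' x j * w' y (j::nat))"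
    using assms(2) unfolding gram_kernel_def by blast
  show ?thesis
  proof (rule gram_kernelI)
    show "finite ({..<m} \<times> {..<m'})"
      by simp
    show "K x y * K' x y = (\<Sum>p\<in>{..<m} \<times> {..<m'}. (w x (fst p) * w' x (snd p)) * (w y (fst p) * w' y (snd p)))"
      if "x \<in> X" "y \<in> X" for x y
      unfolding w[OF that] w'[OF that] sum_product sum.cartesian_product
      by (intro sum.cong) (auto simp: mult_ac)
  qed
qed

lemma gram_kernel_add:
  assumes "gram_kernel X K" "gram_kernel X K'"
  shows "gram_kernel X (\<lambda>x y. K x y + K' x y)"
proof -
  obtain m w where w: "\<And>x y. x \<in> X \<Longrightarrow> y \<in> X \<Longrightarrow> K x y = (\<Sum>j<m. w x j * w y (j::nat))"
    using assms(1) unfolding gram_kernel_def by blast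
  obtain m' w' where w': "\<And>x y. x \<in> X \<Longrightarrow> y \<in> X \<Longrightarrow> K' x y = (\<Sum>j<m'. w' x j * w' y (j::nat))"
    using assms(2) unfolding gram_kernel_def by blast
  show ?thesis
  proof (rule gram_kernelI)
    show "finite ({..<m} <+> {..<m'})"
      by simp
    show "K x y + K' x y = (\<Sum>s\<in>{..<m} <+> {..<m'}. case_sum (w x) (w' x) s * case_sum (w y) (w' y) s)"
      if "x \<in> X" "y \<in> X" for x y
      unfolding w[OF that] w'[OF that] by (subst sum.Plus) auto
  qed
qed

lemma gram_kernel_power:
  assumes "gram_kernel X K"
  shows "gram_kernel X (\<lambda>x y. K x y ^ n)"
proof (induction n)
  case 0
  show ?case
    by (rule gram_kernelI[where J = "{()}" and w = "\<lambda>_ _. 1"]) auto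
next
  case (Suc n)
  then show ?case
    using gram_kernel_mult[OF assms] by simp
qed

lemma gram_kernel_scale:
  assumes "gram_kernel X K" "c \<ge> 0"
  shows "gram_kernel X (\<lambda>x y. c * K x y)"
proof -
  have "gram_kernel X (\<lambda>_ _. c)"
    using assms(2) by (intro gram_kernelI[where J = "{()}" and w = "\<lambda>_ _. sqrt c"]) auto
  from gram_kernel_mult[OF this assms(1)] show ?thesis .
qed

lemma gram_kernel_diagonal:
  assumes "finite X" and c: "\<And>x. x \<in> X \<Longrightarrow> 0 \<le> c x"
  shows "gram_kernel X (\<lambda>x y. if x = y then c x else 0)"
proof (rule gram_kernelI[OF assms(1)])
  fix x y
  assume xy: "x \<in> X" "y \<in> X"
  have "(\<Sum>z\<in>X. (if z = x then sqrt (c x) else 0) * (if z = y then sqrt (c y) else 0))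
      = (\<Sum>z\<in>X. if z = x then if x = y then c x else 0 else 0)"
    using c[OF xy(1)] by (intro sum.cong) auto
  then show "(if x = y then c x else 0)
      = (\<Sum>z\<in>X. (if z = x then sqrt (c x) else 0) * (if z = y then sqrt (c y) else 0))"
    using assms(1) xy by simp
qed

lemma gram_kernel_sum_pullback:
  assumes "gram_kernel Y K" and act: "\<And>g x. g \<in> G \<Longrightarrow> x \<in> X \<Longrightarrow> act g x \<in> Y"
  shows "gram_kernel X (\<lambda>x y. \<Sum>g\<in>G. \<Sum>h\<in>G. K (act g x) (act h y))"
proof -
  obtain m w where w: "\<And>x y. x \<in> Y \<Longrightarrow> y \<in> Y \<Longrightarrow> K x y = (\<Sum>j<m. w x j * w y (j::nat))"
    using assms(1) unfolding gram_kernel_def by blast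
  show ?thesis
  proof (rule gram_kernelI)
    show "finite {..<m}"
      by simp
    fix x y
    assume xy: "x \<in> X" "y \<in> X"
    have "(\<Sum>g\<in>G. \<Sum>h\<in>G. K (act g x) (act h y))
        = (\<Sum>g\<in>G. \<Sum>h\<in>G. \<Sum>j<m. w (act g x) j * w (act h y) j)"
      using xy act by (intro sum.cong refl w) auto
    also have "\<dots> = (\<Sum>g\<in>G. \<Sum>j<m. \<Sum>h\<in>G. w (act g x) j * w (act h y) j)"
      by (intro sum.cong refl sum.swap)
    also have "\<dots> = (\<Sum>j<m. \<Sum>g\<in>G. \<Sum>h\<in>G. w (act g x) j * w (act h y) j)"
      by (rule sum.swap)
    finally show "(\<Sum>g\<in>G. \<Sum>h\<in>G. K (act g x) (act h y))
        = (\<Sum>j<m. (\<Sum>g\<in>G. w (act g x) j) * (\<Sum>h\<in>G. w (act h y) j))"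
      by (simp add: sum_product)
  qed
qed

text \<open>The squared distance between vectors of squared norm \<open>R\<close> with inner product
  \<open>K x y\<close>. The diagonal of \<open>K\<close> does not enter. The value 0 outside
  \<open>X\<close> makes nonnegativity and symmetry hold on the whole type, as
  \<open>Metric_space\<close> demands.\<close>

definition kernel_dist :: "'a set \<Rightarrow> real \<Rightarrow> ('a \<Rightarrow> 'a \<Rightarrow> real) \<Rightarrow> 'a \<Rightarrow> 'a \<Rightarrow> real" where
  "kernel_dist X R K x y = (if x \<in> X \<and> y \<in> X \<and> x \<noteq> y then 2 * (R - K x y) else 0)"

text \<open>Orthogonal coordinates, one for each point, raise all norms to \<open>sqrt R\<close> without changing the
  inner products of distinct points.\<close>

lemma negative_type_kernel_dist:
  assumes X: "finite X" and K: "gram_kernel X K"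
    and less: "\<And>x y. x \<in> X \<Longrightarrow> y \<in> X \<Longrightarrow> K x y < R"
    and triangle: "\<And>x y z. x \<in> X \<Longrightarrow> y \<in> X \<Longrightarrow> z \<in> X \<Longrightarrow> K x y + K x z \<le> R + K y z"
  shows "negative_type X (kernel_dist X R K)"
proof -
  have sym: "K x y = K y x" if "x \<in> X" "y \<in> X" for x y
    using K that unfolding gram_kernel_def by (auto simp: mult.commute)
  have nonneg: "0 \<le> kernel_dist X R K x y" for x y
    using less[of x y] by (auto simp: kernel_dist_def)
  have tri: "kernel_dist X R K x z \<le> kernel_dist X R K x y + kernel_dist X R K y z"
    if "x \<in> X" "y \<in> X" "z \<in> X" for x y z
  proof -
    consider "x = y \<or> y = z" | "x = z" | "x \<noteq> y" "y \<noteq> z" "x \<noteq> z"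
      by blast
    then show ?thesis
    proof cases
      case 2
      then show ?thesis
        using nonneg[of x y] nonneg[of y z] add_nonneg_nonneg by (simp add: kernel_dist_def[of _ _ _ z z])
    next
      case 3
      then show ?thesis
        using triangle[of y x z] sym that by (simp add: kernel_dist_def)
    qed (use nonneg in \<open>auto simp: kernel_dist_def\<close>)
  qed
  have metric: "Metric_space X (kernel_dist X R K)"
  proof
    show "kernel_dist X R K x y = kernel_dist X R K y x" for x y
      using sym by (auto simp: kernel_dist_def)
    show "kernel_dist X R K x y = 0 \<longleftrightarrow> x = y" if "x \<in> X" "y \<in> X" for x y
      using less[OF that] that by (auto simp: kernel_dist_def)
  qed (use nonneg tri in auto)
  define L where "L x y = K x y + (if x = y then R - K x x else 0)" for x y
  have "gram_kernel X L"
    unfolding L_def using X K less by (intro gram_kernel_add gram_kernel_diagonal) (auto simp: less_imp_le)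
  then obtain m w where w: "\<And>x y. x \<in> X \<Longrightarrow> y \<in> X \<Longrightarrow> L x y = (\<Sum>j<m. w x j * w y (j::nat))"
    unfolding gram_kernel_def by blast
  have "kernel_dist X R K x y = (L2_set (\<lambda>i. w x i - w y i) {..<m})\<^sup>2" if "x \<in> X" "y \<in> X" for x y
  proof -
    have "(L2_set (\<lambda>i. w x i - w y i) {..<m})\<^sup>2 = (\<Sum>i<m. (w x i - w y i)\<^sup>2)"
      unfolding L2_set_def by (intro real_sqrt_pow2 sum_nonneg) auto
    also have "\<dots> = (\<Sum>i<m. w x i * w x i + w y i * w y i - 2 * (w x i * w y i))"
      by (intro sum.cong refl) (simp add: power2_eq_square algebra_simps)
    also have "\<dots> = L x x + L y y - 2 * L x y"
      unfolding w[OF that] w[OF that(1,1)] w[OF that(2,2)]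
      by (simp add: sum.distrib sum_subtractf sum_distrib_left)
    also have "\<dots> = kernel_dist X R K x y"
      using that by (simp add: L_def kernel_dist_def)
    finally show ?thesis
      by simp
  qed
  moreover have "L2_set (\<lambda>i. restrict (w x) {..<m} i - restrict (w y) {..<m} i) {..<m}
      = L2_set (\<lambda>i. w x i - w y i) {..<m}" for x y
    by (intro L2_set_cong) auto
  ultimately have "\<forall>x\<in>X. \<forall>y\<in>X. kernel_dist X R K x y
      = (L2_set (\<lambda>i. restrict (w x) {..<m} i - restrict (w y) {..<m} i) {..<m})\<^sup>2"
    by metis
  moreover have "(\<lambda>x. restrict (w x) {..<m}) \<in> X \<rightarrow> real_vectors m"
    by (auto simp: real_vectors_def)
  ultimately have "\<exists>m. \<exists>v \<in> X \<rightarrow> real_vectors m. \<forall>x\<in>X. \<forall>y\<in>X.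
      kernel_dist X R K x y = (L2_set (\<lambda>i. v x i - v y i) {..<m})\<^sup>2"
    by (intro exI[of _ m] bexI[of _ "\<lambda>x. restrict (w x) {..<m}"])
  with X metric show ?thesis
    unfolding negative_type_def by blast
qed

section \<open>Quotients of the cube by block translations\<close>

text \<open>The cube \<open>{-1, 1}\<^sup>k\<close> is the power set of an index set consisting of \<open>2 ^ m\<close> blocks of size
  \<open>L\<close>; the blocks are permuted by translations of the group \<open>(\<int>/2)\<^sup>m\<close>, realised as
  \<open>Pow {..<m}\<close> with symmetric difference.\<close>

locale block_cube =
  fixes m L :: nat
  assumes L_pos: "0 < L"
begin

definition G :: "nat set set" where "G = Pow {..<m}"

definition I :: "(nat set \<times> nat) set" where "I = G \<times> {..<L}"

definition act :: "nat set \<Rightarrow> nat set \<times> nat \<Rightarrow> nat set \<times> nat" where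
  "act g i = (sym_diff (fst i) g, snd i)"

definition shift :: "nat set \<Rightarrow> (nat set \<times> nat) set \<Rightarrow> (nat set \<times> nat) set" where
  "shift g A = act g ` A"

definition corr :: "(nat set \<times> nat) set \<Rightarrow> (nat set \<times> nat) set \<Rightarrow> real" where
  "corr A B = (\<Sum>i\<in>I. signum_at A i * signum_at B i) / card I"

definition K :: "(nat set \<times> nat) set \<Rightarrow> (nat set \<times> nat) set \<Rightarrow> real" where
  "K A B = (\<Sum>g\<in>G. corr A (shift g B) ^ 10)"

definition good :: "real \<Rightarrow> (nat set \<times> nat) set \<Rightarrow> bool" where
  "good \<epsilon> A \<longleftrightarrow> A \<subseteq> I \<and> (\<forall>g\<in>G - {{}}. \<bar>corr A (shift g A)\<bar> \<le> \<epsilon>)"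

lemma finite_G [simp]: "finite G" and empty_in_G [simp]: "{} \<in> G"
  by (auto simp: G_def)

lemma card_G: "card G = 2 ^ m"
  by (simp add: G_def card_Pow)

lemma finite_I [simp]: "finite I"
  by (simp add: I_def)

lemma card_I: "card I = 2 ^ m * L"
  by (simp add: I_def card_G)

lemma I_nonempty [simp]: "I \<noteq> {}"
  using L_pos empty_in_G unfolding I_def by blast

lemma card_I_pos: "0 < card I"
  by (simp add: card_gt_0_iff)

lemma sym_diff_in_G [simp]: "g \<in> G \<Longrightarrow> h \<in> G \<Longrightarrow> sym_diff g h \<in> G"
  by (auto simp: G_def)

lemma sym_diff_cancel: "sym_diff g (sym_diff g h) = h" "sym_diff (sym_diff h g) g = h"
  by auto

lemma act_in_I [simp]: "g \<in> G \<Longrightarrow> i \<in> I \<Longrightarrow> act g i \<in> I"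
  by (auto simp: I_def act_def simp flip: Un_Diff)

lemma act_act: "act g (act h i) = act (sym_diff g h) i"
  by (auto simp: act_def)

lemma act_empty [simp]: "act {} i = i"
  by (simp add: act_def)

lemma act_self [simp]: "act g (act g i) = i"
  by (simp add: act_act)

lemma act_eq_iff: "act g i = act h i \<longleftrightarrow> g = h"
  by (auto simp: act_def)

lemma bij_act: "g \<in> G \<Longrightarrow> bij_betw (act g) I I"
  by (rule bij_betw_byWitness[where f' = "act g"]) auto

lemma mem_shift: "i \<in> shift g A \<longleftrightarrow> act g i \<in> A"
  unfolding shift_def by (metis act_self imageE imageI)

lemma signum_at_shift [simp]: "signum_at (shift g A) i = signum_at A (act g i)"
  by (simp add: signum_at_def mem_shift)

lemma shift_shift: "shift g (shift h A) = shift (sym_diff g h) A"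
  by (simp add: shift_def image_image act_act)

lemma shift_empty [simp]: "shift {} A = A"
  by (simp add: shift_def)

lemma shift_self [simp]: "shift g (shift g A) = A"
  by (simp add: shift_shift)

lemma shift_subset [simp]: "g \<in> G \<Longrightarrow> A \<subseteq> I \<Longrightarrow> shift g A \<subseteq> I"
  by (auto simp: shift_def)

lemma shift_flip: "shift g (sym_diff A {i}) = sym_diff (shift g A) {act g i}"
  unfolding set_eq_iff by (auto simp: mem_shift)

lemma bij_shift: "g \<in> G \<Longrightarrow> bij_betw (shift g) (Pow I) (Pow I)"
  by (rule bij_betw_byWitness[where f' = "shift g"]) (simp_all add: image_subset_iff)

lemma bij_translate: "g \<in> G \<Longrightarrow> bij_betw (\<lambda>h. sym_diff h g) G G"
  by (rule bij_betw_byWitness[where f' = "\<lambda>h. sym_diff h g"]) (auto simp: sym_diff_cancel G_def)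

lemma corr_sym: "corr A B = corr B A"
  by (simp add: corr_def mult.commute)

lemma corr_self [simp]: "corr A A = 1"
  using card_I_pos by (simp add: corr_def)

lemma corr_shift_both: "g \<in> G \<Longrightarrow> corr (shift g A) (shift g B) = corr A B"
  unfolding corr_def
  using sum.reindex_bij_betw[OF bij_act, of g "\<lambda>i. signum_at A i * signum_at B i"] by simp

lemma corr_shift_left: "g \<in> G \<Longrightarrow> corr (shift g A) B = corr A (shift g B)"
  using corr_shift_both[of g A "shift g B"] by simp

lemma abs_corr_le_1: "\<bar>corr A B\<bar> \<le> 1"
proof -
  have "\<bar>\<Sum>i\<in>I. signum_at A i * signum_at B i\<bar> \<le> (\<Sum>i\<in>I. \<bar>signum_at A i * signum_at B i\<bar>)"
    by (rule sum_abs)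
  also have "\<dots> = card I"
    by (simp add: abs_mult)
  finally show ?thesis
    using card_I_pos by (simp add: corr_def divide_le_eq_1)
qed

text \<open>The triangle inequality for Hamming distances, up to complementation of the sets.\<close>

lemma corr_triangle: "\<bar>corr A B\<bar> + \<bar>corr A C\<bar> \<le> 1 + \<bar>corr B C\<bar>"
proof -
  have *: "s * corr A B + t * corr A C \<le> 1 + s * t * corr B C" if "s \<in> {-1, 1}" "t \<in> {-1, 1}" for s t :: real
  proof -
    have "(\<Sum>i\<in>I. s * (signum_at A i * signum_at B i) + t * (signum_at A i * signum_at C i))
        \<le> (\<Sum>i\<in>I. 1 + s * t * (signum_at B i * signum_at C i))"
      using that by (intro sum_mono) (auto simp: signum_at_def)
    then have "(\<Sum>i\<in>I. s * (signum_at A i * signum_at B i) + t * (signum_at A i * signum_at C i)) / card I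
        \<le> (\<Sum>i\<in>I. 1 + s * t * (signum_at B i * signum_at C i)) / card I"
      by (rule divide_right_mono) simp
    then show ?thesis
      by (simp add: corr_def sum.distrib add_divide_distrib flip: sum_distrib_left)
  qed
  define s t where "s = (if corr A B < 0 then -1 else 1 :: real)"
    and "t = (if corr A C < 0 then -1 else 1 :: real)"
  have "\<bar>corr A B\<bar> = s * corr A B" "\<bar>corr A C\<bar> = t * corr A C"
    by (auto simp: s_def t_def)
  moreover have "s * t * corr B C \<le> \<bar>corr B C\<bar>"
    by (auto simp: s_def t_def)
  moreover have "s \<in> {-1, 1}" "t \<in> {-1, 1}"
    by (auto simp: s_def t_def)
  ultimately show ?thesis
    using *[of s t] by linarith
qed

lemma K_sym: "K A B = K B A"
  unfolding K_def by (intro sum.cong refl) (metis corr_shift_left corr_sym)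

lemma K_shift: "g \<in> G \<Longrightarrow> K A (shift g B) = K A B"
  unfolding K_def shift_shift
  using sum.reindex_bij_betw[OF bij_translate, of g "\<lambda>h. corr A (shift h B) ^ 10"] by simp

lemma K_shift_left: "g \<in> G \<Longrightarrow> K (shift g A) B = K A B"
  using K_shift K_sym by metis

lemma K_nonneg: "0 \<le> K A B"
  by (auto simp: K_def intro: sum_nonneg)

lemma K_ge_corr: "corr A B ^ 10 \<le> K A B"
  unfolding K_def using member_le_sum[of "{}" G "\<lambda>g. corr A (shift g B) ^ 10"] by simp

text \<open>The one-sided sum over the group equals the average over shifts of both arguments,
  because correlations are invariant under simultaneous shifts; the two-sided form is visibly a Gram
  kernel, with vectors summed over orbits.\<close>

lemma gram_kernel_K: "gram_kernel X K"
proof -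
  have "gram_kernel UNIV (\<lambda>A B. 1 / card I * (\<Sum>i\<in>I. signum_at A i * signum_at B i))"
    by (intro gram_kernel_scale gram_kernelI[OF finite_I]) auto
  then have "gram_kernel UNIV (\<lambda>A B. corr A B ^ 10)"
    by (intro gram_kernel_power) (simp add: corr_def)
  then have "gram_kernel X (\<lambda>A B. 1 / card G * (\<Sum>g\<in>G. \<Sum>h\<in>G. corr (shift g A) (shift h B) ^ 10))"
    by (intro gram_kernel_scale gram_kernel_sum_pullback[where Y = UNIV]) auto
  moreover have "(\<Sum>g\<in>G. \<Sum>h\<in>G. corr (shift g A) (shift h B) ^ 10) = card G * K A B" for A B
  proof -
    have "(\<Sum>g\<in>G. \<Sum>h\<in>G. corr (shift g A) (shift h B) ^ 10) = (\<Sum>g\<in>G. K (shift g A) B)"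
      by (simp add: K_def)
    then show ?thesis
      by (simp add: K_shift_left)
  qed
  ultimately show ?thesis
    by (simp add: card_G)
qed

lemma good_shift:
  assumes "good \<epsilon> A" "g \<in> G"
  shows "good \<epsilon> (shift g A)"
proof -
  have "corr (shift g A) (shift h (shift g A)) = corr A (shift h A)" for h
    using corr_shift_both[OF assms(2), of A "shift h A"] by (simp add: shift_shift Un_commute)
  then show ?thesis
    using assms by (simp add: good_def)
qed

lemma good_pair:
  assumes "good \<epsilon> A" "g \<in> G" "h \<in> G" "g \<noteq> h"
  shows "\<bar>corr (shift g A) (shift h A)\<bar> \<le> \<epsilon>"
proof -
  have "sym_diff g h \<in> G - {{}}"
    using assms by auto
  then have "\<bar>corr A (shift (sym_diff g h) A)\<bar> \<le> \<epsilon>"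
    using assms(1) by (simp add: good_def)
  then show ?thesis
    using assms(2) by (simp add: corr_shift_left shift_shift)
qed

text \<open>Bessel's inequality for the nearly orthonormal orbit of \<open>B\<close>.\<close>

lemma sum_corr_square_le:
  assumes B: "good \<epsilon> B" and \<epsilon>: "0 \<le> \<epsilon>" "2 ^ m * \<epsilon> \<le> 1"
  shows "(\<Sum>g\<in>G. (corr A (shift g B))\<^sup>2) \<le> 2"
proof -
  define a where "a g = corr A (shift g B)" for g
  define S where "S = (\<Sum>g\<in>G. (a g)\<^sup>2)"
  \<comment> \<open>The combination of the orbit of \<open>B\<close> with coefficients
    \<open>a\<close>. Its inner product with \<open>A\<close> is \<open>S * card I\<close>, and
    near-orthogonality bounds its norm in terms of \<open>S\<close>.\<close>
  define f where "f i = (\<Sum>g\<in>G. a g * signum_at (shift g B) i)" for i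
  have S0: "S \<ge> 0"
    by (auto simp: S_def intro: sum_nonneg)
  have "S = (\<Sum>g\<in>G. \<Sum>i\<in>I. a g * (signum_at A i * signum_at (shift g B) i)) / card I"
    unfolding S_def power2_eq_square sum_divide_distrib
    by (subst (2) a_def) (simp only: corr_def sum_distrib_left times_divide_eq_right sum_divide_distrib)
  also have "(\<Sum>g\<in>G. \<Sum>i\<in>I. a g * (signum_at A i * signum_at (shift g B) i)) = (\<Sum>i\<in>I. signum_at A i * f i)"
    by (subst sum.swap) (simp add: f_def sum_distrib_left mult_ac)
  finally have "S * card I = (\<Sum>i\<in>I. signum_at A i * f i)"
    by simp
  then have "(S * card I)\<^sup>2 \<le> (\<Sum>i\<in>I. (signum_at A i)\<^sup>2) * (\<Sum>i\<in>I. (f i)\<^sup>2)"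
    using Cauchy_Schwarz_ineq_sum by metis
  also have "\<dots> = card I * (\<Sum>i\<in>I. (f i)\<^sup>2)"
    by (simp add: power2_eq_square)
  also have "(\<Sum>i\<in>I. (f i)\<^sup>2) = (\<Sum>g\<in>G. \<Sum>h\<in>G. a g * a h * (corr (shift g B) (shift h B) * card I))"
  proof -
    have "(\<Sum>i\<in>I. (f i)\<^sup>2) = (\<Sum>i\<in>I. \<Sum>g\<in>G. \<Sum>h\<in>G. a g * a h * (signum_at (shift g B) i * signum_at (shift h B) i))"
      unfolding f_def power2_eq_square sum_product by (intro sum.cong refl) (simp only: mult_ac)
    also have "\<dots> = (\<Sum>g\<in>G. \<Sum>i\<in>I. \<Sum>h\<in>G. a g * a h * (signum_at (shift g B) i * signum_at (shift h B) i))"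
      by (rule sum.swap)
    also have "\<dots> = (\<Sum>g\<in>G. \<Sum>h\<in>G. \<Sum>i\<in>I. a g * a h * (signum_at (shift g B) i * signum_at (shift h B) i))"
      by (intro sum.cong refl sum.swap)
    finally show ?thesis
      using card_I_pos by (simp add: corr_def sum_distrib_left)
  qed
  also have "\<dots> \<le> (\<Sum>g\<in>G. \<Sum>h\<in>G. (of_bool (g = h) * (a g)\<^sup>2 + \<epsilon> * (\<bar>a g\<bar> * \<bar>a h\<bar>)) * card I)"
  proof (intro sum_mono)
    fix g h
    assume gh: "g \<in> G" "h \<in> G"
    have "a g * a h * corr (shift g B) (shift h B) \<le> of_bool (g = h) * (a g)\<^sup>2 + \<epsilon> * (\<bar>a g\<bar> * \<bar>a h\<bar>)"
    proof (cases "g = h")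
      case False
      have "a g * a h * corr (shift g B) (shift h B) \<le> \<bar>a g\<bar> * \<bar>a h\<bar> * \<bar>corr (shift g B) (shift h B)\<bar>"
        by (metis abs_ge_self abs_mult)
      also have "\<dots> \<le> \<bar>a g\<bar> * \<bar>a h\<bar> * \<epsilon>"
        using good_pair[OF B gh False] by (intro mult_left_mono) auto
      finally show ?thesis
        using False by (simp add: mult_ac)
    qed (use \<epsilon> in \<open>simp add: power2_eq_square\<close>)
    then have "a g * a h * corr (shift g B) (shift h B) * card I
        \<le> (of_bool (g = h) * (a g)\<^sup>2 + \<epsilon> * (\<bar>a g\<bar> * \<bar>a h\<bar>)) * card I"
      by (intro mult_right_mono) auto
    then show "a g * a h * (corr (shift g B) (shift h B) * card I)
        \<le> (of_bool (g = h) * (a g)\<^sup>2 + \<epsilon> * (\<bar>a g\<bar> * \<bar>a h\<bar>)) * card I"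
      by (simp only: mult.assoc)
  qed
  also have "\<dots> = (S + \<epsilon> * (\<Sum>g\<in>G. \<bar>a g\<bar>)\<^sup>2) * card I"
    unfolding sum_distrib_right[symmetric] sum.distrib sum_distrib_left[symmetric]
    by (simp add: S_def power2_eq_square of_bool_def if_distrib[of "\<lambda>x. x * _"] sum_product cong: if_cong)
  also have "(\<Sum>g\<in>G. \<bar>a g\<bar>)\<^sup>2 \<le> 2 ^ m * S"
    using Cauchy_Schwarz_ineq_sum[of "\<lambda>_. 1" "\<lambda>g. \<bar>a g\<bar>" G] by (simp add: S_def card_G)
  finally have "(S * card I)\<^sup>2 \<le> card I * ((S + \<epsilon> * (2 ^ m * S)) * card I)"
    using \<epsilon> by (simp add: mult_left_mono mult_right_mono)
  then have "S * S \<le> S + \<epsilon> * (2 ^ m * S)"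
    using card_I_pos by (simp add: power2_eq_square mult_ac)
  also have "\<dots> = S * (1 + 2 ^ m * \<epsilon>)"
    by (simp add: algebra_simps)
  also have "\<dots> \<le> S * 2"
    using S0 \<epsilon> by (intro mult_left_mono) auto
  finally have "S \<le> 2"
    using S0 by (cases "S = 0") auto
  then show ?thesis
    by (simp add: S_def a_def)
qed

text \<open>By symmetry the orbit of \<open>C\<close> may be taken to contain the best correlation
  with \<open>A\<close>. Invariance of \<open>K\<close> allows \<open>C\<close> to be replaced by
  its best shift, which then serves as the point \<open>z\<close> of
  \<open>orbit_kernel_triangle\<close>; the even exponent hides the absolute values.\<close>

lemma K_triangle:
  assumes A: "good \<epsilon> A" and B: "good \<epsilon> B" and C: "good \<epsilon> C"
    and \<epsilon>: "0 \<le> \<epsilon>" "2 ^ m * \<epsilon> \<le> 1" "3072 * \<epsilon> ^ 7 \<le> \<sigma>"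
  shows "K A B + K A C \<le> 1 + \<sigma> + K B C"
proof -
  have abs10: "\<bar>x\<bar> ^ 10 = x ^ 10" for x :: real
    by (simp add: power_even_abs)
  have \<epsilon>1: "\<epsilon> \<le> 1"
    using \<epsilon> mult_right_mono[of 1 "2 ^ m" \<epsilon>] by simp
  have ex_max: "\<exists>g0\<in>G. \<forall>g\<in>G. f g \<le> f g0" for f :: "nat set \<Rightarrow> real"
    using Max_in[of "f ` G"] Max_ge[of "f ` G"] by (metis (no_types, lifting) empty_in_G finite_G finite_imageI imageE imageI empty_iff image_is_empty)
  have main: "K A B + K A C \<le> 1 + \<sigma> + K B C"
    if B: "good \<epsilon> B" and C: "good \<epsilon> C" and g1: "g1 \<in> G" "\<And>g. g \<in> G \<Longrightarrow> \<bar>corr A (shift g B)\<bar> \<le> \<bar>corr A (shift g1 B)\<bar>"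
      and g0: "g0 \<in> G" "\<And>g. g \<in> G \<Longrightarrow> \<bar>corr A (shift g C)\<bar> \<le> \<bar>corr A (shift g0 C)\<bar>"
      and le: "\<bar>corr A (shift g1 B)\<bar> \<le> \<bar>corr A (shift g0 C)\<bar>" for B C g0 g1
  proof -
    have pair: "\<bar>corr A (shift g D)\<bar> + \<bar>corr A (shift h D)\<bar> \<le> 1 + \<epsilon>"
      if "good \<epsilon> D" "g \<in> G" "h \<in> G" "g \<noteq> h" for D g h
      using corr_triangle[of A "shift g D" "shift h D"] good_pair[OF that] by linarith
    have "(\<Sum>g\<in>G. \<bar>corr A (shift g B)\<bar> ^ 10) + (\<Sum>g\<in>G. \<bar>corr A (shift g C)\<bar> ^ 10)
        \<le> 1 + \<sigma> + (\<Sum>g\<in>G. \<bar>corr (shift g0 C) (shift g B)\<bar> ^ 10)"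
    proof (rule orbit_kernel_triangle[where \<epsilon> = \<epsilon>, OF finite_G g0(1) g1(1)])
      show "\<bar>corr A (shift g B)\<bar> - (1 - \<bar>corr A (shift g0 C)\<bar>) \<le> \<bar>corr (shift g0 C) (shift g B)\<bar>" for g
        using corr_triangle[of A "shift g B" "shift g0 C"] corr_sym[of "shift g0 C" "shift g B"] by simp
    qed (use g0 g1 le pair B C \<epsilon> \<epsilon>1 abs_corr_le_1 sum_corr_square_le in auto)
    also have "(\<Sum>g\<in>G. \<bar>corr (shift g0 C) (shift g B)\<bar> ^ 10) = K (shift g0 C) B"
      by (simp only: K_def abs10)
    also have "\<dots> = K B C"
      using g0 by (simp add: K_shift_left K_sym[of C B])
    finally show ?thesis
      by (simp only: K_def abs10)
  qed
  obtain g1 where g1: "g1 \<in> G" "\<And>g. g \<in> G \<Longrightarrow> \<bar>corr A (shift g B)\<bar> \<le> \<bar>corr A (shift g1 B)\<bar>"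
    using ex_max[of "\<lambda>g. \<bar>corr A (shift g B)\<bar>"] by blast
  obtain g0 where g0: "g0 \<in> G" "\<And>g. g \<in> G \<Longrightarrow> \<bar>corr A (shift g C)\<bar> \<le> \<bar>corr A (shift g0 C)\<bar>"
    using ex_max[of "\<lambda>g. \<bar>corr A (shift g C)\<bar>"] by blast
  show ?thesis
  proof (cases "\<bar>corr A (shift g1 B)\<bar> \<le> \<bar>corr A (shift g0 C)\<bar>")
    case True
    then show ?thesis
      using main[OF B C g1 g0] by simp
  next
    case False
    then have "K A C + K A B \<le> 1 + \<sigma> + K C B"
      using main[OF C B g0 g1] by simp
    then show ?thesis
      by (simp add: K_sym[of C B])
  qed
qed

text \<open>The triangle inequality with \<open>C = B\<close> bounds \<open>2 * K A B\<close> by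
  \<open>1 + \<sigma> + K B B\<close>, so only the diagonal has to be estimated, and there all
  nontrivial shifts are nearly orthogonal.\<close>

lemma K_less:
  assumes A: "good \<epsilon> A" and B: "good \<epsilon> B"
    and \<epsilon>: "0 \<le> \<epsilon>" "2 ^ m * \<epsilon> \<le> 1" "3072 * \<epsilon> ^ 7 \<le> \<sigma>" and \<sigma>: "0 < \<sigma>"
  shows "K A B < 1 + \<sigma>"
proof -
  have \<epsilon>1: "\<epsilon> \<le> 1"
    using \<epsilon> mult_right_mono[of 1 "2 ^ m" \<epsilon>] by simp
  have "K B B = corr B (shift {} B) ^ 10 + (\<Sum>g\<in>G - {{}}. corr B (shift g B) ^ 10)"
    unfolding K_def by (rule sum.remove) auto
  also have "(\<Sum>g\<in>G - {{}}. corr B (shift g B) ^ 10) \<le> (\<Sum>g\<in>G - {{}}. \<epsilon> ^ 10)"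
  proof (rule sum_mono)
    fix g
    assume "g \<in> G - {{}}"
    then have "\<bar>corr B (shift g B)\<bar> ^ 10 \<le> \<epsilon> ^ 10"
      using B by (intro power_mono) (auto simp: good_def)
    then show "corr B (shift g B) ^ 10 \<le> \<epsilon> ^ 10"
      by (simp add: power_even_abs)
  qed
  also have "\<dots> \<le> (\<Sum>g\<in>G. \<epsilon> ^ 10)"
    using \<epsilon> by (intro sum_mono2) auto
  also have "\<dots> = (2 ^ m * \<epsilon>) * \<epsilon> ^ 9"
    by (simp add: card_G power_Suc[of \<epsilon> 9, simplified])
  also have "\<dots> \<le> 1 * \<epsilon> ^ 7"
    using \<epsilon> \<epsilon>1 by (intro mult_mono power_decreasing) auto
  finally have "K B B < 1 + \<sigma>"
    using \<epsilon>(3) \<sigma> by simp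
  then show ?thesis
    using K_triangle[OF A B B \<epsilon>] by simp
qed

end

section \<open>Moments of correlations at random points of the cube\<close>

lemma cube_mean_signum_product:
  assumes "finite I" "i \<in> I" "j \<in> I"
  shows "cube_mean I (\<lambda>A. signum_at A i * signum_at A j) = of_bool (i = j)"
proof (cases "i = j")
  case False
  have "cube_mean I (\<lambda>A. signum_at A i * signum_at A j)
      = cube_mean I (\<lambda>A. signum_at (sym_diff A {i}) i * signum_at (sym_diff A {i}) j)"
    by (rule cube_mean_reindex[OF bij_betw_flip[OF assms(2)], symmetric])
  also have "\<dots> = cube_mean I (\<lambda>A. (-1) * (signum_at A i * signum_at A j))"
    using False by (intro cube_mean_cong) (auto simp: signum_at_def)
  also have "\<dots> = - cube_mean I (\<lambda>A. signum_at A i * signum_at A j)"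
    by (subst cube_mean_cmult) simp
  finally show ?thesis
    using False by simp
qed (use assms(1) in \<open>simp add: cube_mean_const\<close>)

text \<open>Bonami's inequality applies with coefficients at most \<open>2\<close>, since each pair \<open>{i, \<pi> i}\<close> arises from
  at most two indices \<open>i\<close>.\<close>

lemma fourth_moment_pairs:
  assumes I: "finite I" and \<pi>: "\<And>i. i \<in> I \<Longrightarrow> \<pi> i \<in> I" "\<And>i. i \<in> I \<Longrightarrow> \<pi> i \<noteq> i"
  shows "cube_mean I (\<lambda>A. (\<Sum>i\<in>I. signum_at A i * signum_at A (\<pi> i)) ^ 4) \<le> 324 * (card I)\<^sup>2"
proof -
  define c where "c S = card {i \<in> I. {i, \<pi> i} = S}" for S
  have c0: "c S = 0 \<or> card S = 2" for S
  proof (cases "{i \<in> I. {i, \<pi> i} = S} = {}")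
    case False
    then obtain i where "i \<in> I" "{i, \<pi> i} = S"
      by blast
    then show ?thesis
      using \<pi>(2)[of i] by auto
  qed (simp only: c_def card.empty simp_thms)
  have c2: "c S \<le> 2" if "S \<in> Pow I" for S
  proof (cases "c S = 0")
    case False
    have "c S \<le> card S"
      unfolding c_def using that I by (intro card_mono) (auto intro: finite_subset)
    then show ?thesis
      using c0[of S] False by simp
  qed simp
  have "(\<Sum>S\<in>Pow I. c S) = (\<Sum>S\<in>Pow I. \<Sum>i\<in>{i \<in> I. {i, \<pi> i} = S}. 1)"
    by (simp add: c_def)
  also have "\<dots> = (\<Sum>i\<in>I. 1)"
    using I \<pi> by (intro sum.group) auto
  finally have c_sum: "(\<Sum>S\<in>Pow I. c S) = card I"
    by simp
  \<comment> \<open>Only sets of size 2 occur, where the noise factor is \<open>1 / 3\<close>; the 3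
    compensates for it. Squaring with \<open>c S \<le> 2\<close> then gives
    \<open>9 * 2 = 18\<close> per unit of \<open>c\<close>, and 324 is the square of 18.\<close>
  have form: "(\<Sum>i\<in>I. signum_at A i * signum_at A (\<pi> i))
      = (\<Sum>S\<in>Pow I. (1 / sqrt 3) ^ card S * (3 * real (c S)) * walsh S A)" for A
  proof -
    have "(\<Sum>i\<in>I. signum_at A i * signum_at A (\<pi> i)) = (\<Sum>i\<in>I. walsh {i, \<pi> i} A)"
    proof (rule sum.cong[OF refl])
      fix i
      assume "i \<in> I"
      then show "signum_at A i * signum_at A (\<pi> i) = walsh {i, \<pi> i} A"
        using \<pi>(2)[of i] by (simp add: walsh_def)
    qed
    also have "\<dots> = (\<Sum>S\<in>Pow I. \<Sum>i\<in>{i \<in> I. {i, \<pi> i} = S}. walsh {i, \<pi> i} A)"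
      using I \<pi> by (intro sum.group[symmetric]) auto
    also have "\<dots> = (\<Sum>S\<in>Pow I. real (c S) * walsh S A)"
      by (intro sum.cong refl) (simp add: c_def)
    also have "\<dots> = (\<Sum>S\<in>Pow I. (1 / sqrt 3) ^ card S * (3 * real (c S)) * walsh S A)"
    proof (rule sum.cong[OF refl])
      fix S
      show "real (c S) * walsh S A = (1 / sqrt 3) ^ card S * (3 * real (c S)) * walsh S A"
        using c0[of S] by (auto simp: power_divide)
    qed
    finally show ?thesis .
  qed
  have "cube_mean I (\<lambda>A. (\<Sum>i\<in>I. signum_at A i * signum_at A (\<pi> i)) ^ 4) \<le> (\<Sum>S\<in>Pow I. (3 * real (c S))\<^sup>2)\<^sup>2"
    unfolding form by (rule bonami[OF I])
  also have "\<dots> \<le> (\<Sum>S\<in>Pow I. 18 * real (c S))\<^sup>2"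
  proof (intro power_mono sum_mono sum_nonneg)
    fix S
    assume "S \<in> Pow I"
    then have "real (c S) * real (c S) \<le> 2 * real (c S)"
      using c2[of S] by (intro mult_right_mono) auto
    then show "(3 * real (c S))\<^sup>2 \<le> 18 * real (c S)"
      by (simp add: power2_eq_square)
  qed auto
  also have "\<dots> = 324 * (card I)\<^sup>2"
    using c_sum by (simp add: power_mult_distrib flip: sum_distrib_left of_nat_sum)
  finally show ?thesis .
qed

context block_cube
begin

lemma cube_mean_corr_square: "cube_mean I (\<lambda>B. (corr A B)\<^sup>2) = 1 / card I"
proof -
  have "(corr A B)\<^sup>2 = 1 / (card I)\<^sup>2 *
      (\<Sum>i\<in>I. \<Sum>j\<in>I. signum_at A i * signum_at A j * (signum_at B i * signum_at B j))" for B
    by (simp add: corr_def power2_eq_square sum_product mult_ac)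
  then have "cube_mean I (\<lambda>B. (corr A B)\<^sup>2) = 1 / (card I)\<^sup>2 *
      (\<Sum>i\<in>I. \<Sum>j\<in>I. signum_at A i * signum_at A j * cube_mean I (\<lambda>B. signum_at B i * signum_at B j))"
    by (simp only: cube_mean_cmult cube_mean_sum)
  also have "(\<Sum>i\<in>I. \<Sum>j\<in>I. signum_at A i * signum_at A j * cube_mean I (\<lambda>B. signum_at B i * signum_at B j))
      = (\<Sum>i\<in>I. \<Sum>j\<in>I. if i = j then 1 else 0)"
    by (intro sum.cong refl) (auto simp: cube_mean_signum_product)
  also have "\<dots> = card I"
    by simp
  finally show ?thesis
    using card_I_pos by (simp add: power2_eq_square)
qed

text \<open>Tenth powers are bounded by squares, whose mean is \<open>1 / card I\<close> for every
  shift. With few shifts compared to coordinates, typical orbits are therefore at distance close to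
  2.\<close>

lemma cube_mean_K_le: "cube_mean I (\<lambda>B. K A B) \<le> 2 ^ m / card I"
proof -
  have "cube_mean I (\<lambda>B. K A B) = (\<Sum>g\<in>G. cube_mean I (\<lambda>B. corr A (shift g B) ^ 10))"
    by (simp add: K_def cube_mean_sum)
  also have "\<dots> = (\<Sum>g\<in>G. cube_mean I (\<lambda>B. corr A B ^ 10))"
    by (intro sum.cong refl cube_mean_reindex[OF bij_shift])
  also have "\<dots> \<le> (\<Sum>g\<in>G. cube_mean I (\<lambda>B. (corr A B)\<^sup>2))"
  proof (intro sum_mono cube_mean_mono)
    fix B
    have "\<bar>corr A B\<bar> ^ 10 \<le> \<bar>corr A B\<bar> ^ 2"
      by (intro power_decreasing abs_corr_le_1) auto
    then show "corr A B ^ 10 \<le> (corr A B)\<^sup>2"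
      by (simp add: power_even_abs)
  qed
  also have "\<dots> = 2 ^ m / card I"
    by (simp add: cube_mean_corr_square card_G)
  finally show ?thesis .
qed

text \<open>Markov's inequality for fourth moments and a union bound over the group. Second moments
  would give a bound of order \<open>2 ^ m / (\<epsilon>\<^sup>2 * card I)\<close>, too large for
  the density \<open>1 / card I\<close> that the edge estimate requires.\<close>

lemma cube_mean_bad_le:
  assumes \<epsilon>: "0 < \<epsilon>"
  shows "cube_mean I (\<lambda>A. of_bool (\<not> good \<epsilon> A)) \<le> 324 * 2 ^ m / (\<epsilon> ^ 4 * (card I)\<^sup>2)"
proof -
  have abs4: "\<bar>x\<bar> ^ 4 = x ^ 4" for x :: real
    by (simp add: power_even_abs)
  have "cube_mean I (\<lambda>A. of_bool (\<not> good \<epsilon> A))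
      \<le> cube_mean I (\<lambda>A. \<Sum>g\<in>G - {{}}. 1 / \<epsilon> ^ 4 * corr A (shift g A) ^ 4)"
  proof (rule cube_mean_mono)
    fix A
    assume "A \<subseteq> I"
    show "of_bool (\<not> good \<epsilon> A) \<le> (\<Sum>g\<in>G - {{}}. 1 / \<epsilon> ^ 4 * corr A (shift g A) ^ 4)"
    proof (cases "good \<epsilon> A")
      case False
      then obtain h where h: "h \<in> G - {{}}" "\<epsilon> < \<bar>corr A (shift h A)\<bar>"
        using \<open>A \<subseteq> I\<close> by (auto simp: good_def not_le)
      have "\<epsilon> ^ 4 \<le> \<bar>corr A (shift h A)\<bar> ^ 4"
        using h \<epsilon> by (intro power_mono) auto
      then have "1 \<le> 1 / \<epsilon> ^ 4 * corr A (shift h A) ^ 4"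
        using \<epsilon> by (simp add: abs4 field_simps)
      also have "\<dots> \<le> (\<Sum>g\<in>G - {{}}. 1 / \<epsilon> ^ 4 * corr A (shift g A) ^ 4)"
        using h(1) \<epsilon> by (intro member_le_sum) auto
      finally show ?thesis
        using False by simp
    qed (use \<epsilon> in \<open>auto intro: sum_nonneg\<close>)
  qed
  also have "\<dots> = (\<Sum>g\<in>G - {{}}. 1 / \<epsilon> ^ 4 * cube_mean I (\<lambda>A. corr A (shift g A) ^ 4))"
    by (simp only: cube_mean_sum cube_mean_cmult)
  also have "\<dots> \<le> (\<Sum>g\<in>G - {{}}. 1 / \<epsilon> ^ 4 * (324 / (card I)\<^sup>2))"
  proof (intro sum_mono mult_left_mono)
    fix g
    assume g: "g \<in> G - {{}}"
    have "cube_mean I (\<lambda>A. corr A (shift g A) ^ 4)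
        = 1 / (card I) ^ 4 * cube_mean I (\<lambda>A. (\<Sum>i\<in>I. signum_at A i * signum_at A (act g i)) ^ 4)"
      by (subst cube_mean_cmult[symmetric]) (simp add: corr_def power_divide)
    also have "\<dots> \<le> 1 / (card I) ^ 4 * (324 * (card I)\<^sup>2)"
    proof (intro mult_left_mono fourth_moment_pairs)
      show "act g i \<noteq> i" for i
        using g act_eq_iff[of g i "{}"] by simp
    qed (use g in auto)
    also have "\<dots> = 324 / (card I)\<^sup>2"
      using card_I_pos by (simp add: power2_eq_square power4_eq_xxxx)
    finally show "cube_mean I (\<lambda>A. corr A (shift g A) ^ 4) \<le> 324 / (card I)\<^sup>2" .
  qed (use \<epsilon> in auto)
  also have "\<dots> \<le> (\<Sum>g\<in>G. 1 / \<epsilon> ^ 4 * (324 / (card I)\<^sup>2))"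
    using \<epsilon> by (intro sum_mono2) auto
  also have "\<dots> = 324 * 2 ^ m / (\<epsilon> ^ 4 * (card I)\<^sup>2)"
    by (simp add: card_G)
  finally show ?thesis .
qed

text \<open>The influences are equal along each orbit of coordinates, and these orbits have size \<open>2 ^ m\<close>.\<close>

lemma influence_shift_invariant:
  assumes f: "\<And>g A. g \<in> G \<Longrightarrow> A \<subseteq> I \<Longrightarrow> f (shift g A) = f A" and i: "i \<in> I"
  shows "2 ^ m * influence I f i \<le> (\<Sum>j\<in>I. influence I f j)"
proof -
  have inf_eq: "influence I f (act g i) = influence I f i" if g: "g \<in> G" for g
  proof -
    have "influence I f i = cube_mean I (\<lambda>A. \<bar>f (shift g A) - f (sym_diff (shift g A) {act g i})\<bar>)"
      unfolding influence_def
    proof (rule cube_mean_cong)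
      fix A
      assume A: "A \<subseteq> I"
      then have "sym_diff A {i} \<subseteq> I"
        using i by auto
      then show "\<bar>f A - f (sym_diff A {i})\<bar> = \<bar>f (shift g A) - f (sym_diff (shift g A) {act g i})\<bar>"
        using f[OF g] A by (simp only: shift_flip[symmetric])
    qed
    also have "\<dots> = influence I f (act g i)"
      unfolding influence_def
      by (rule cube_mean_reindex[OF bij_shift[OF g], of "\<lambda>A. \<bar>f A - f (sym_diff A {act g i})\<bar>"])
    finally show ?thesis
      by simp
  qed
  have "inj_on (\<lambda>g. act g i) G"
    by (simp add: inj_on_def act_eq_iff)
  then have "(\<Sum>j\<in>(\<lambda>g. act g i) ` G. influence I f j) = (\<Sum>g\<in>G. influence I f (act g i))"
    by (simp add: sum.reindex)
  also have "\<dots> = 2 ^ m * influence I f i"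
    by (simp add: inf_eq card_G)
  finally have "2 ^ m * influence I f i = (\<Sum>j\<in>(\<lambda>g. act g i) ` G. influence I f j)"
    by simp
  also have "\<dots> \<le> (\<Sum>j\<in>I. influence I f j)"
    using i by (intro sum_mono2 influence_nonneg) auto
  finally show ?thesis .
qed

text \<open>The metric of \<open>\<ell>\<^sub>1\<close> is a sum of line metrics, one per
  coordinate, so the real-valued inequality can be summed. Threshold functions of invariant
  functions are invariant, hence no influence exceeds a \<open>2 ^ m\<close> fraction of the total,
  and \<open>128 ^ D = 2 ^ (7 * D)\<close>.\<close>

lemma l1_poincare:
  assumes F: "\<And>g A. g \<in> G \<Longrightarrow> A \<subseteq> I \<Longrightarrow> F (shift g A) = F A" and D: "0 < D" "7 * D \<le> m"
  shows "real D * cube_mean I (\<lambda>A. cube_mean I (\<lambda>B. l1_dist n (F A) (F B)))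
    \<le> (\<Sum>i\<in>I. cube_mean I (\<lambda>A. l1_dist n (F A) (F (sym_diff A {i}))))"
proof -
  have "(128 :: real) ^ D = 2 ^ (7 * D)"
    by (simp add: power_mult)
  also have "\<dots> \<le> 2 ^ m"
    using D by (intro power_increasing) auto
  finally have "real D * cube_mean I (\<lambda>A. cube_mean I (\<lambda>B. \<bar>F A j - F B j\<bar>)) \<le> (\<Sum>i\<in>I. influence I (\<lambda>A. F A j) i)" for j
    by (rule kkl_real[OF finite_I D(1)]) (rule influence_shift_invariant, simp_all add: F)
  then have "(\<Sum>j<n. real D * cube_mean I (\<lambda>A. cube_mean I (\<lambda>B. \<bar>F A j - F B j\<bar>)))
      \<le> (\<Sum>j<n. \<Sum>i\<in>I. influence I (\<lambda>A. F A j) i)"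
    by (rule sum_mono)
  moreover have "(\<Sum>j<n. \<Sum>i\<in>I. influence I (\<lambda>A. F A j) i) = (\<Sum>i\<in>I. \<Sum>j<n. influence I (\<lambda>A. F A j) i)"
    by (rule sum.swap)
  ultimately show ?thesis
    by (simp add: l1_dist_def influence_def cube_mean_sum flip: sum_distrib_left)
qed

end

section \<open>Distortion of the quotient metric\<close>

lemma l1_dist_nonneg: "0 \<le> l1_dist n x y"
  by (simp add: l1_dist_def sum_nonneg)

context block_cube
begin

text \<open>The choice depends on the orbit as a set only, so all its elements receive the same
  representative and the quotient can be realised inside the cube.\<close>

definition orbit_rep :: "(nat set \<times> nat) set \<Rightarrow> (nat set \<times> nat) set" where
  "orbit_rep A = (SOME B. B \<in> (\<lambda>g. shift g A) ` G)"

definition points :: "real \<Rightarrow> (nat set \<times> nat) set set" where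
  "points \<epsilon> = orbit_rep ` {A. good \<epsilon> A}"

lemma orbit_rep_eq_shift: "\<exists>g\<in>G. orbit_rep A = shift g A"
proof -
  have "orbit_rep A \<in> (\<lambda>g. shift g A) ` G"
    unfolding orbit_rep_def by (rule someI[of _ "shift {} A"]) (rule imageI[OF empty_in_G])
  then show ?thesis
    by auto
qed

lemma orbit_rep_shift:
  assumes "g \<in> G"
  shows "orbit_rep (shift g A) = orbit_rep A"
proof -
  have "(\<lambda>h. shift h (shift g A)) ` G = (\<lambda>h. shift h A) ` ((\<lambda>h. sym_diff h g) ` G)"
    by (simp add: shift_shift image_image)
  also have "(\<lambda>h. sym_diff h g) ` G = G"
    using bij_translate[OF assms] by (rule bij_betw_imp_surj_on)
  finally show ?thesis
    by (simp add: orbit_rep_def)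
qed

lemma K_orbit_rep: "K (orbit_rep A) (orbit_rep B) = K A B"
  using orbit_rep_eq_shift[of A] orbit_rep_eq_shift[of B] by (auto simp: K_shift K_shift_left)

lemma good_orbit_rep: "good \<epsilon> A \<Longrightarrow> good \<epsilon> (orbit_rep A)"
  using orbit_rep_eq_shift[of A] good_shift by auto

lemma good_iff_shift: "g \<in> G \<Longrightarrow> good \<epsilon> (shift g A) \<longleftrightarrow> good \<epsilon> A"
  using good_shift[of \<epsilon> A g] good_shift[of \<epsilon> "shift g A" g] by auto

lemma points_good: "x \<in> points \<epsilon> \<Longrightarrow> good \<epsilon> x"
  by (auto simp: points_def good_orbit_rep)

lemma points_subset: "points \<epsilon> \<subseteq> Pow I"
  using points_good by (auto simp: good_def)

lemma finite_points: "finite (points \<epsilon>)"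
  by (rule finite_subset[OF points_subset]) simp

lemma card_points_le: "card (points \<epsilon>) \<le> 2 ^ card I"
  using card_mono[OF _ points_subset, of \<epsilon>] by (simp add: card_Pow)

lemma corr_flip:
  assumes "i \<in> I"
  shows "corr A (sym_diff A {i}) = 1 - 2 / card I"
proof -
  have "(\<Sum>j\<in>I. signum_at A j * signum_at (sym_diff A {i}) j) = (\<Sum>j\<in>I. 1 - (if j = i then 2 else 0))"
    by (intro sum.cong refl) (auto simp: signum_at_def)
  also have "\<dots> = real (card I) - 2"
    using assms by (simp add: sum_subtractf)
  finally show ?thesis
    using card_I_pos by (simp add: corr_def diff_divide_distrib)
qed

end

text \<open>With \<open>M = 2 ^ m\<close> there are \<open>M ^ 10\<close> coordinates and
  \<open>\<epsilon>\<close> will be \<open>1 / M\<^sup>2\<close>. The slack then exceeds the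
  residue, since \<open>3072 / M ^ 14 \<le> 1 / M ^ 10\<close>, and bad sets have density at most
  \<open>324 / M ^ 11\<close>, hence at most \<open>1 / M ^ 10\<close>. The assumption
  \<open>2 \<le> D\<close> gives \<open>M \<ge> 2 ^ 14\<close>, which swallows the
  constants.\<close>

locale gap_cube = block_cube +
  fixes D :: nat
  assumes D: "2 \<le> D" and m_eq: "m = 7 * D" and L_eq: "L = (2 ^ m) ^ 9"
begin

definition \<epsilon> :: real where "\<epsilon> = 1 / (2 ^ m)\<^sup>2"

definition R :: real where "R = 1 + 1 / card I"

definition X :: "(nat set \<times> nat) set set" where "X = points \<epsilon>"

lemma card_I_eq: "card I = (2 ^ m) ^ 10"
proof -
  have "card I = 2 ^ m * (2 ^ m) ^ 9"
    using card_I by (rule trans) (rule arg_cong[OF L_eq])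
  then show ?thesis
    by (simp flip: power_mult power_add)
qed

lemma M_ge: "(2 :: real) ^ 14 \<le> 2 ^ m"
  using D m_eq by (intro power_increasing) auto

lemma \<epsilon>_pos: "0 < \<epsilon>"
  by (simp add: \<epsilon>_def)

lemma \<epsilon>_small: "2 ^ m * \<epsilon> \<le> 1"
  by (simp add: \<epsilon>_def power2_eq_square)

lemma \<epsilon>_power_7: "3072 * \<epsilon> ^ 7 \<le> 1 / card I"
proof -
  define M :: real where "M = 2 ^ m"
  have M: "3072 \<le> M ^ 4" "0 < M"
    using power_mono[of 3072 M 4] self_le_power[of M 4] M_ge by (auto simp: M_def)
  have "3072 * \<epsilon> ^ 7 = 3072 / (M ^ 10 * M ^ 4)"
    by (simp add: \<epsilon>_def M_def[symmetric] power_divide flip: power_mult power_add)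
  also have "\<dots> = 1 / M ^ 10 * (3072 / M ^ 4)"
    by simp
  also have "\<dots> \<le> 1 / M ^ 10 * 1"
    using M by (intro mult_left_mono) auto
  finally show ?thesis
    by (simp add: card_I_eq M_def)
qed

lemma bad_le: "cube_mean I (\<lambda>A. of_bool (\<not> good \<epsilon> A)) \<le> 1 / card I"
proof -
  define M :: real where "M = 2 ^ m"
  have M: "324 \<le> M"
    using M_ge by (simp add: M_def)
  have k: "real (card I) = M ^ 10"
    by (simp add: card_I_eq M_def)
  have "cube_mean I (\<lambda>A. of_bool (\<not> good \<epsilon> A)) \<le> 324 * M / (\<epsilon> ^ 4 * (card I)\<^sup>2)"
    unfolding M_def by (rule cube_mean_bad_le[OF \<epsilon>_pos])
  also have "\<dots> = 324 * M / (M ^ 10 * M\<^sup>2)"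
    using M unfolding \<epsilon>_def M_def[symmetric]
    by (simp add: k power_divide divide_simps flip: power_mult power_add)
  also have "\<dots> = 324 / (M ^ 10 * M)"
    using M by (simp add: power2_eq_square)
  also have "\<dots> \<le> 1 / M ^ 10"
    using M by (simp add: field_simps)
  finally show ?thesis
    by (simp add: k)
qed

lemma K_less_R: "x \<in> X \<Longrightarrow> y \<in> X \<Longrightarrow> K x y < R"
  unfolding X_def R_def using \<epsilon>_pos \<epsilon>_small \<epsilon>_power_7 card_I_pos
  by (intro K_less[of \<epsilon>] points_good) auto

lemma K_triangle_R: "x \<in> X \<Longrightarrow> y \<in> X \<Longrightarrow> z \<in> X \<Longrightarrow> K x y + K x z \<le> R + K y z"
  unfolding X_def R_def using \<epsilon>_pos \<epsilon>_small \<epsilon>_power_7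
  by (intro K_triangle[of \<epsilon>] points_good) auto

lemma finite_X: "finite X"
  unfolding X_def by (rule finite_points)

lemma orbit_rep_in_X: "good \<epsilon> A \<Longrightarrow> orbit_rep A \<in> X"
  by (simp add: X_def points_def)

lemma R_bounds: "1 < R" "R \<le> 2"
  using card_I_pos by (auto simp: R_def)

lemma kernel_dist_ge:
  assumes "good \<epsilon> A" "good \<epsilon> B"
  shows "2 * (1 - K A B) \<le> kernel_dist X R K (orbit_rep A) (orbit_rep B)"
proof (cases "orbit_rep A = orbit_rep B")
  case True
  have "1 \<le> K (orbit_rep A) (orbit_rep A)"
    using K_ge_corr[of "orbit_rep A" "orbit_rep A"] by simp
  then have "1 \<le> K A B"
    using K_orbit_rep[of A B] True by simp
  then show ?thesis
    using True by (simp add: kernel_dist_def)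
qed (use assms R_bounds in \<open>simp add: kernel_dist_def orbit_rep_in_X K_orbit_rep\<close>)

lemma kernel_dist_le:
  assumes "good \<epsilon> A" "good \<epsilon> B"
  shows "kernel_dist X R K (orbit_rep A) (orbit_rep B) \<le> 2 * (R - K A B)"
  using K_less_R[OF orbit_rep_in_X orbit_rep_in_X, OF assms]
  by (auto simp: kernel_dist_def K_orbit_rep)

lemma kernel_dist_le_4: "x \<in> X \<Longrightarrow> y \<in> X \<Longrightarrow> kernel_dist X R K x y \<le> 4"
  using K_nonneg[of x y] R_bounds by (simp add: kernel_dist_def)

text \<open>One flip changes the correlation by \<open>2 / card I\<close>, hence its tenth power by
  at most \<open>20 / card I\<close>; the slack adds \<open>1 / card I\<close>, and the distance
  doubles the total of 21.\<close>

lemma kernel_dist_edge: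
  assumes "good \<epsilon> A" "good \<epsilon> (sym_diff A {i})" "i \<in> I"
  shows "kernel_dist X R K (orbit_rep A) (orbit_rep (sym_diff A {i})) \<le> 42 / card I"
proof -
  have k: "2 \<le> card I"
  proof -
    have "(2 :: nat) ^ 1 \<le> 2 ^ (m * 10)"
      using D m_eq by (intro power_increasing) auto
    then show ?thesis
      by (simp add: card_I_eq power_mult)
  qed
  have "1 - 20 / card I \<le> (1 - 2 / card I) ^ 10"
    using Bernoulli_inequality[of "- 2 / card I" 10] k by (simp add: field_simps)
  also have "\<dots> \<le> K A (sym_diff A {i})"
    using K_ge_corr[of A "sym_diff A {i}"] corr_flip[OF assms(3)] by simp
  finally show ?thesis
    using kernel_dist_le[OF assms(1,2)] by (simp add: R_def)
qed

text \<open>An embedding of the good orbits is extended to the whole cube by a constant. The bad sets have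
  density at most \<open>1 / card I\<close>, so the edges meeting them contribute no more than the others.\<close>

lemma distortion_lower_bound:
  fixes F :: "(nat set \<times> nat) set \<Rightarrow> nat \<Rightarrow> real"
  assumes lower: "\<And>x y. x \<in> X \<Longrightarrow> y \<in> X \<Longrightarrow> kernel_dist X R K x y \<le> l1_dist n (F x) (F y)"
    and upper: "\<And>x y. x \<in> X \<Longrightarrow> y \<in> X \<Longrightarrow> l1_dist n (F x) (F y) \<le> \<Gamma> * kernel_dist X R K x y"
    and \<Gamma>: "0 \<le> \<Gamma>"
  shows "real D \<le> 50 * \<Gamma>"
proof -
  define bad :: "(nat set \<times> nat) set \<Rightarrow> real" where "bad A = of_bool (\<not> good \<epsilon> A)" for A
  define k where "k = real (card I)"
  define \<beta> where "\<beta> = cube_mean I bad"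
  have \<beta>: "\<beta> \<le> 1 / k"
    unfolding \<beta>_def bad_def k_def by (rule bad_le)
  have k: "k = (2 ^ m) ^ 10" "0 < k"
    using card_I_pos by (simp_all add: k_def card_I_eq)
  have M_k: "2 ^ m / k \<le> 1 / 16" and k_inv: "1 / k \<le> 1 / 16"
  proof -
    have "(2 :: real) ^ m * 16 \<le> 2 ^ m * 2 ^ m"
      using M_ge by (intro mult_left_mono) auto
    also have "\<dots> = (2 ^ m)\<^sup>2"
      by (simp add: power2_eq_square)
    also have "\<dots> \<le> k"
      unfolding k by (intro power_increasing) auto
    finally show "2 ^ m / k \<le> 1 / 16"
      using k(2) by (simp add: field_simps)
    have "1 / k \<le> 2 ^ m / k"
      using k(2) by (intro divide_right_mono) auto
    then show "1 / k \<le> 1 / 16"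
      using \<open>2 ^ m / k \<le> 1 / 16\<close> by linarith
  qed
  obtain A0 where A0: "good \<epsilon> A0"
  proof -
    have False if "\<And>A. \<not> good \<epsilon> A"
    proof -
      have "bad = (\<lambda>_. 1)"
        using that by (auto simp: bad_def)
      then have "\<beta> = 1"
        by (simp add: \<beta>_def cube_mean_const)
      then show False
        using \<beta> k_inv by simp
    qed
    then show ?thesis
      using that by blast
  qed
  define r where "r A = (if good \<epsilon> A then orbit_rep A else orbit_rep A0)" for A
  have r: "r A \<in> X" for A
    using A0 by (simp add: r_def orbit_rep_in_X)
  have r_shift: "r (shift g A) = r A" if "g \<in> G" for g A
    using that by (simp add: r_def good_iff_shift orbit_rep_shift)
  define E where "E A B = l1_dist n (F (r A)) (F (r B))" for A B
  have poincare: "real D * cube_mean I (\<lambda>A. cube_mean I (E A)) \<le> (\<Sum>i\<in>I. cube_mean I (\<lambda>A. E A (sym_diff A {i})))"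
    unfolding E_def by (rule l1_poincare[of "\<lambda>A. F (r A)"]) (use r_shift D m_eq in auto)
  \<comment> \<open>The constant is \<open>42 + 4 * 2\<close>: an edge with a bad endpoint has
    length at most 4, and each of its two endpoints is bad with density at most
    \<open>1 / k\<close>.\<close>
  have edge: "cube_mean I (\<lambda>A. E A (sym_diff A {i})) \<le> 50 * \<Gamma> / k" if i: "i \<in> I" for i
  proof -
    have "E A (sym_diff A {i}) \<le> 42 * \<Gamma> / k + 4 * \<Gamma> * (bad A + bad (sym_diff A {i}))" for A
    proof -
      have E: "E A (sym_diff A {i}) \<le> \<Gamma> * kernel_dist X R K (r A) (r (sym_diff A {i}))"
        unfolding E_def by (rule upper[OF r r])
      show ?thesis
      proof (cases "good \<epsilon> A \<and> good \<epsilon> (sym_diff A {i})")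
        case True
        then have "\<Gamma> * kernel_dist X R K (r A) (r (sym_diff A {i})) \<le> \<Gamma> * (42 / k)"
          using kernel_dist_edge[OF _ _ i] \<Gamma> by (intro mult_left_mono) (auto simp: r_def k_def)
        then show ?thesis
          using E True by (simp add: bad_def mult.commute)
      next
        case False
        have "\<Gamma> * kernel_dist X R K (r A) (r (sym_diff A {i})) \<le> \<Gamma> * 4"
          using kernel_dist_le_4[OF r r] \<Gamma> by (intro mult_left_mono) auto
        also have "\<dots> \<le> 4 * \<Gamma> * (bad A + bad (sym_diff A {i}))"
          using False \<Gamma> by (auto simp: bad_def)
        also have "\<dots> \<le> 42 * \<Gamma> / k + 4 * \<Gamma> * (bad A + bad (sym_diff A {i}))"
          using \<Gamma> k by simp
        finally show ?thesis
          using E by linarith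
      qed
    qed
    then have "cube_mean I (\<lambda>A. E A (sym_diff A {i}))
        \<le> cube_mean I (\<lambda>A. 42 * \<Gamma> / k + 4 * \<Gamma> * (bad A + bad (sym_diff A {i})))"
      by (rule cube_mean_mono)
    also have "\<dots> = 42 * \<Gamma> / k + 4 * \<Gamma> * (\<beta> + \<beta>)"
      unfolding cube_mean_add cube_mean_cmult cube_mean_const[OF finite_I] \<beta>_def
      by (subst cube_mean_reindex[OF bij_betw_flip[OF i]]) (rule refl)
    also have "\<dots> \<le> 42 * \<Gamma> / k + 4 * \<Gamma> * (1 / k + 1 / k)"
      using \<beta> \<Gamma> by (intro add_left_mono mult_left_mono) auto
    also have "\<dots> = 50 * \<Gamma> / k"
      by (simp add: field_simps)
    finally show ?thesis .
  qed
  have "(\<Sum>i\<in>I. cube_mean I (\<lambda>A. E A (sym_diff A {i}))) \<le> (\<Sum>i\<in>I. 50 * \<Gamma> / k)"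
    by (intro sum_mono edge)
  also have "\<dots> = 50 * \<Gamma>"
    using k by (simp add: k_def[symmetric])
  finally have up: "(\<Sum>i\<in>I. cube_mean I (\<lambda>A. E A (sym_diff A {i}))) \<le> 50 * \<Gamma>" .
  \<comment> \<open>Subtracting 2 for each bad argument makes the left side nonpositive on bad
    pairs, because \<open>K\<close> is nonnegative, so the bound can be averaged over the whole
    cube.\<close>
  have pair: "2 * (1 - K A B) - 2 * bad A - 2 * bad B \<le> E A B" for A B
  proof (cases "good \<epsilon> A \<and> good \<epsilon> B")
    case True
    then have "2 * (1 - K A B) \<le> kernel_dist X R K (r A) (r B)"
      using kernel_dist_ge by (simp add: r_def)
    also have "\<dots> \<le> E A B"
      unfolding E_def by (rule lower[OF r r])
    finally show ?thesis
      using True by (simp add: bad_def)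
  next
    case False
    then have "2 * (1 - K A B) - 2 * bad A - 2 * bad B \<le> 0"
      using K_nonneg[of A B] by (auto simp: bad_def)
    also have "0 \<le> E A B"
      unfolding E_def by (rule l1_dist_nonneg)
    finally show ?thesis .
  qed
  have "1 \<le> 2 - 2 * (2 ^ m / k) - 4 * \<beta>"
    using M_k k_inv \<beta> by linarith
  also have "\<dots> = cube_mean I (\<lambda>A. 2 - 2 * (2 ^ m / k) - 2 * bad A - 2 * \<beta>)"
    unfolding cube_mean_diff cube_mean_cmult cube_mean_const[OF finite_I] \<beta>_def[symmetric] by simp
  also have "\<dots> \<le> cube_mean I (\<lambda>A. cube_mean I (E A))"
  proof (rule cube_mean_mono)
    fix A
    have "2 - 2 * (2 ^ m / k) - 2 * bad A - 2 * \<beta> \<le> 2 - 2 * cube_mean I (K A) - 2 * bad A - 2 * \<beta>"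
      using cube_mean_K_le[of A] by (simp add: k_def)
    also have "\<dots> = cube_mean I (\<lambda>B. 2 - 2 * K A B - 2 * bad A - 2 * bad B)"
      unfolding cube_mean_diff cube_mean_cmult cube_mean_const[OF finite_I] \<beta>_def ..
    also have "\<dots> \<le> cube_mean I (E A)"
      using pair[of A] by (intro cube_mean_mono) (simp add: algebra_simps)
    finally show "2 - 2 * (2 ^ m / k) - 2 * bad A - 2 * \<beta> \<le> cube_mean I (E A)" .
  qed
  finally have "real D * 1 \<le> real D * cube_mean I (\<lambda>A. cube_mean I (E A))"
    by (intro mult_left_mono) auto
  then show ?thesis
    using poincare up by linarith
qed

end

section \<open>Spaces with exactly n points\<close>

text \<open>Added points have kernel value 0 with every point, so they lie at distance
  \<open>2 * R\<close> from all others. Since \<open>K\<close> is nonnegative no distance is larger,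
  and since \<open>K\<close> stays below \<open>R\<close> the triangle inequalities through added
  points hold.\<close>

lemma negative_type_padding:
  assumes X: "finite X" "card X \<le> n" and gram: "gram_kernel X K" and R: "0 < R"
    and nonneg: "\<And>x y. x \<in> X \<Longrightarrow> y \<in> X \<Longrightarrow> 0 \<le> K x y"
    and less: "\<And>x y. x \<in> X \<Longrightarrow> y \<in> X \<Longrightarrow> K x y < R"
    and triangle: "\<And>x y z. x \<in> X \<Longrightarrow> y \<in> X \<Longrightarrow> z \<in> X \<Longrightarrow> K x y + K x z \<le> R + K y z"
  obtains Y :: "nat set" and d \<iota> where "card Y = n" "negative_type Y d" "\<iota> \<in> X \<rightarrow> Y"
    "\<And>x y. x \<in> X \<Longrightarrow> y \<in> X \<Longrightarrow> d (\<iota> x) (\<iota> y) = kernel_dist X R K x y"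
proof -
  obtain \<iota> where \<iota>: "bij_betw \<iota> X {..<card X}"
    using ex_bij_betw_finite_nat[OF X(1)] by (auto simp: atLeast0LessThan)
  define \<beta> where "\<beta> = the_inv_into X \<iota>"
  have \<beta>: "\<beta> i \<in> X" if "i < card X" for i
    using bij_betw_the_inv_into[OF \<iota>] that by (auto simp: \<beta>_def bij_betw_def)
  have \<beta>\<iota>: "\<beta> (\<iota> x) = x" if "x \<in> X" for x
    using \<iota> that by (simp add: \<beta>_def bij_betw_def the_inv_into_f_f)
  have \<iota>_less: "\<iota> x < card X" if "x \<in> X" for x
    using \<iota> that by (auto simp: bij_betw_def)
  define K' where "K' i j = (if i < card X \<and> j < card X then K (\<beta> i) (\<beta> j) else 0)" for i j
  have "gram_kernel {..<n} K'"
  proof -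
    obtain m w where w: "\<And>x y. x \<in> X \<Longrightarrow> y \<in> X \<Longrightarrow> K x y = (\<Sum>j<m. w x j * w y (j::nat))"
      using gram unfolding gram_kernel_def by blast
    show ?thesis
      by (rule gram_kernelI[of "{..<m}" _ _ "\<lambda>i. if i < card X then w (\<beta> i) else (\<lambda>_. 0)"])
        (auto simp: K'_def w \<beta>)
  qed
  moreover have "K' i j < R" for i j
    using R less \<beta> by (simp add: K'_def)
  moreover have "K' i j + K' i l \<le> R + K' j l" for i j l
  proof -
    have "K' i j \<le> R" "K' i l \<le> R" "0 \<le> K' j l"
      using R less nonneg \<beta> by (auto simp: K'_def less_imp_le)
    then show ?thesis
      using triangle[OF \<beta> \<beta> \<beta>, of i j l] R by (auto simp: K'_def split: if_splits)
  qed
  ultimately have neg: "negative_type {..<n} (kernel_dist {..<n} R K')"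
    by (intro negative_type_kernel_dist) auto
  have "kernel_dist {..<n} R K' (\<iota> x) (\<iota> y) = kernel_dist X R K x y" if "x \<in> X" "y \<in> X" for x y
    using that \<iota>_less[OF that(1)] \<iota>_less[OF that(2)] \<beta>\<iota>[OF that(1)] \<beta>\<iota>[OF that(2)] X(2)
    by (auto simp: kernel_dist_def K'_def)
  moreover have "\<iota> \<in> X \<rightarrow> {..<n}"
    using \<iota>_less X(2) by fastforce
  ultimately show thesis
    using that[of "{..<n}" "kernel_dist {..<n} R K'" \<iota>] neg by simp
qed

text \<open>The cube has \<open>(2 ^ (7 * D)) ^ 10 = 2 ^ (70 * D)\<close> coordinates, whence the
  double exponential; the orbits, at most as many as points of the cube, are padded to
  \<open>n\<close> points.\<close>

lemma exists_large_distortion_space: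
  assumes D: "2 \<le> D" and n: "2 ^ (2 ^ (70 * D)) \<le> n"
  obtains X :: "nat set" and d where "card X = n" "negative_type X d"
    "\<And>\<Gamma>. embeds_into_l1 X d \<Gamma> \<Longrightarrow> real D \<le> 50 * \<Gamma>"
proof -
  interpret gap_cube "7 * D" "(2 ^ (7 * D)) ^ 9" D
    by unfold_locales (use D in auto)
  have "card X \<le> 2 ^ card I"
    unfolding X_def by (rule card_points_le)
  also have "card I = 2 ^ (70 * D)"
    by (rule trans[OF card_I_eq]) (simp flip: power_mult)
  finally have card_X: "card X \<le> n"
    using n by simp
  obtain Y :: "nat set" and d \<iota> where Y: "card Y = n" "negative_type Y d" "\<iota> \<in> X \<rightarrow> Y"
    and d: "\<And>x y. x \<in> X \<Longrightarrow> y \<in> X \<Longrightarrow> d (\<iota> x) (\<iota> y) = kernel_dist X R K x y"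
  proof (rule negative_type_padding[OF finite_X card_X gram_kernel_K])
    show "0 < R"
      using R_bounds by simp
  qed (use K_less_R K_triangle_R K_nonneg in auto)
  have "real D \<le> 50 * \<Gamma>" if emb: "embeds_into_l1 Y d \<Gamma>" for \<Gamma>
  proof -
    obtain m \<phi> where \<phi>: "\<And>x y. x \<in> Y \<Longrightarrow> y \<in> Y \<Longrightarrow> d x y \<le> l1_dist m (\<phi> x) (\<phi> y)"
      "\<And>x y. x \<in> Y \<Longrightarrow> y \<in> Y \<Longrightarrow> l1_dist m (\<phi> x) (\<phi> y) \<le> \<Gamma> * d x y"
      using emb unfolding embeds_into_l1_def embeds_with_distortion_def by blast
    \<comment> \<open>\<open>embeds_into_l1\<close> admits negative \<open>\<Gamma>\<close>.
      Truncation at 0 covers them, and the resulting bound \<open>real D \<le> 0\<close> then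
      contradicts \<open>2 \<le> D\<close>.\<close>
    have "real D \<le> 50 * max 0 \<Gamma>"
    proof (rule distortion_lower_bound[where F = "\<lambda>x. \<phi> (\<iota> x)" and n = m])
      fix x y
      assume xy: "x \<in> X" "y \<in> X"
      then have in_Y: "\<iota> x \<in> Y" "\<iota> y \<in> Y"
        using Y(3) by auto
      show "kernel_dist X R K x y \<le> l1_dist m (\<phi> (\<iota> x)) (\<phi> (\<iota> y))"
        using \<phi>(1)[OF in_Y] d[OF xy] by simp
      have "0 \<le> kernel_dist X R K x y"
        using K_less_R[OF xy] by (simp add: kernel_dist_def)
      then have "\<Gamma> * kernel_dist X R K x y \<le> max 0 \<Gamma> * kernel_dist X R K x y"
        by (intro mult_right_mono) auto
      then show "l1_dist m (\<phi> (\<iota> x)) (\<phi> (\<iota> y)) \<le> max 0 \<Gamma> * kernel_dist X R K x y"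
        using \<phi>(2)[OF in_Y] d[OF xy] by simp
    qed simp
    then show ?thesis
      using D by (simp add: max_def split: if_splits)
  qed
  then show thesis
    using that Y by blast
qed

section \<open>Comparison of the scale D with log log n\<close>

lemma exists_double_exponential_scale:
  fixes n :: nat
  assumes "2 ^ (2 ^ (70 * D0)) \<le> n" "0 < D0"
  obtains D where "D0 \<le> D" "2 ^ (2 ^ (70 * D)) \<le> n" "n < 2 ^ (2 ^ (70 * Suc D))"
proof -
  define P where "P d \<longleftrightarrow> n < 2 ^ (2 ^ (70 * Suc d))" for d
  have "n < 2 ^ n"
    by (rule less_exp)
  also have "(2 :: nat) ^ n \<le> 2 ^ (2 ^ (70 * Suc n))"
  proof (rule power_increasing)
    have "n \<le> 70 * Suc n"
      by simp
    also have "\<dots> \<le> 2 ^ (70 * Suc n)"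
      by (rule less_imp_le[OF less_exp])
    finally show "n \<le> 2 ^ (70 * Suc n)" .
  qed simp
  finally have "P n"
    unfolding P_def .
  define D where "D = (LEAST d. P d)"
  have PD: "P D"
    unfolding D_def by (rule LeastI[of P, OF \<open>P n\<close>])
  have mono: "(2 :: nat) ^ (2 ^ (70 * a)) \<le> 2 ^ (2 ^ (70 * b))" if "a \<le> b" for a b
    using that by (intro power_increasing) auto
  have D0: "D0 \<le> D"
  proof (rule ccontr)
    assume "\<not> D0 \<le> D"
    then have "n < 2 ^ (2 ^ (70 * D0))"
      using PD mono[of "Suc D" D0] unfolding P_def by linarith
    then show False
      using assms by linarith
  qed
  then obtain d where d: "D = Suc d"
    using assms(2) by (cases D) auto
  then have "\<not> P d"
    using not_less_Least[of d P] unfolding D_def[symmetric] by blast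
  then have "2 ^ (2 ^ (70 * D)) \<le> n"
    unfolding P_def d by linarith
  then show thesis
    using that D0 PD unfolding P_def by blast
qed

text \<open>The upper bound says that \<open>D\<close> is at least of order
  \<open>log log n\<close>. The lower bound 1 makes powers of \<open>log log n\<close> monotone in
  the exponent.\<close>

lemma ln_ln_bounds:
  fixes n :: nat
  assumes D: "1 \<le> D" and n: "2 ^ (2 ^ (70 * D)) \<le> n" "n < 2 ^ (2 ^ (70 * Suc D))"
  shows "1 \<le> ln (ln (real n))" and "ln (ln (real n)) \<le> 70 * (real D + 1)"
proof -
  have "(2 :: real) ^ (2 ^ (70 * D)) \<le> real n"
    using n(1) by (metis of_nat_le_iff of_nat_numeral of_nat_power)
  then have "ln ((2 :: real) ^ (2 ^ (70 * D))) \<le> ln (real n)"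
    by (subst ln_le_cancel_iff) (auto intro: less_le_trans[of _ "2 ^ (2 ^ (70 * D))"])
  then have "2 ^ (70 * D) * ln 2 \<le> ln (real n)"
    by (simp add: ln_realpow)
  moreover have "(2 :: real) ^ 3 * (2 / 3) \<le> 2 ^ (70 * D) * ln 2"
    using D by (intro mult_mono power_increasing ln2_ge_two_thirds) auto
  ultimately have ln_ge: "3 \<le> ln (real n)"
    by simp
  then have "ln 3 \<le> ln (ln (real n))"
    by simp
  moreover have "1 \<le> ln (3 :: real)"
    using exp_le by (subst ln_ge_iff) auto
  ultimately show "1 \<le> ln (ln (real n))"
    by linarith
  have n_pos: "0 < n"
    using ln_ge by (cases n) auto
  have "real n \<le> 2 ^ (2 ^ (70 * Suc D))"
    using n(2) by (metis less_imp_le of_nat_le_iff of_nat_numeral of_nat_power)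
  then have "ln (real n) \<le> ln (2 ^ (2 ^ (70 * Suc D)))"
    using n_pos by (subst ln_le_cancel_iff) auto
  also have "\<dots> = 2 ^ (70 * Suc D) * ln 2"
    by (simp only: ln_realpow of_nat_power of_nat_numeral)
  also have "\<dots> \<le> 2 ^ (70 * Suc D) * 1"
    using ln_2_less_1 by (intro mult_left_mono) auto
  finally have "ln (ln (real n)) \<le> ln (2 ^ (70 * Suc D))"
    using ln_ge by (subst ln_le_cancel_iff) auto
  also have "\<dots> = real (70 * Suc D) * ln 2"
    by (simp only: ln_realpow)
  also have "\<dots> \<le> real (70 * Suc D) * 1"
    using ln_2_less_1 by (intro mult_left_mono) auto
  finally show "ln (ln (real n)) \<le> 70 * (real D + 1)"
    by simp
qed

theorem theorem1p2:
  fixes \<delta> :: real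
  assumes "\<delta> > 0"
  shows "\<exists>N::nat. \<forall>n\<ge>N. \<exists>(X :: nat set) d. card X = n \<and> negative_type X d \<and>
           \<not> (\<exists>\<Gamma>. \<Gamma> < ln (ln (real n)) powr (1 / 6 - \<delta>) \<and> embeds_into_l1 X d \<Gamma>)"
proof -
  \<comment> \<open>Large enough for \<open>sqrt (70 * (D + 1)) \<le> D / 50\<close>, which amounts
    to \<open>175000 * (D + 1) \<le> D\<^sup>2\<close>.\<close>
  obtain D0 :: nat where D0: "200000 \<le> D0"
    by blast
  show ?thesis
  proof (intro exI[of _ "2 ^ (2 ^ (70 * D0))"] allI impI)
    fix n :: nat
    assume "2 ^ (2 ^ (70 * D0)) \<le> n"
    then obtain D where D: "D0 \<le> D" "2 ^ (2 ^ (70 * D)) \<le> n" "n < 2 ^ (2 ^ (70 * Suc D))"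
      by (rule exists_double_exponential_scale) (use D0 in auto)
    obtain X :: "nat set" and d where X: "card X = n" "negative_type X d"
      and bound: "\<And>\<Gamma>. embeds_into_l1 X d \<Gamma> \<Longrightarrow> real D \<le> 50 * \<Gamma>"
      by (rule exists_large_distortion_space[OF _ D(2)]) (use D D0 in auto)
    define x where "x = ln (ln (real n))"
    have x: "1 \<le> x" "x \<le> 70 * (real D + 1)"
      unfolding x_def by (rule ln_ln_bounds[OF _ D(2,3)]; use D D0 in simp)+
    have "x powr (1 / 6 - \<delta>) \<le> x powr (1 / 2)"
      using x assms by (intro powr_mono) auto
    also have "\<dots> = sqrt x"
      using x by (simp add: powr_half_sqrt)
    also have "\<dots> \<le> real D / 50"
    proof (rule real_le_lsqrt)
      have D_ge: "200000 \<le> real D"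
        using D(1) D0 by linarith
      then have "200000 * real D \<le> real D * real D"
        by (intro mult_right_mono) auto
      moreover have "175000 * (real D + 1) \<le> 200000 * real D"
        using D_ge by simp
      ultimately have "175000 * (real D + 1) \<le> real D * real D"
        by (rule order_trans[rotated])
      then have "70 * (real D + 1) \<le> (real D / 50)\<^sup>2"
        by (simp add: power2_eq_square)
      then show "x \<le> (real D / 50)\<^sup>2"
        using x by linarith
    qed simp
    finally have x_powr: "x powr (1 / 6 - \<delta>) \<le> real D / 50" .
    have "\<not> (\<exists>\<Gamma>. \<Gamma> < ln (ln (real n)) powr (1 / 6 - \<delta>) \<and> embeds_into_l1 X d \<Gamma>)"
    proof
      assume "\<exists>\<Gamma>. \<Gamma> < ln (ln (real n)) powr (1 / 6 - \<delta>) \<and> embeds_into_l1 X d \<Gamma>"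
      then obtain \<Gamma> where "\<Gamma> < x powr (1 / 6 - \<delta>)" "embeds_into_l1 X d \<Gamma>"
        unfolding x_def by blast
      then show False
        using bound[of \<Gamma>] x_powr by linarith
    qed
    then show "\<exists>(X :: nat set) d. card X = n \<and> negative_type X d \<and>
        \<not> (\<exists>\<Gamma>. \<Gamma> < ln (ln (real n)) powr (1 / 6 - \<delta>) \<and> embeds_into_l1 X d \<Gamma>)"
      using X by blast
  qed
qed

end
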